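(* There is a universal constant $c>0$ such that for any $M,K,R\ge1$, $H,B>0$, $\sigma\ge0$ and any $F\in\mathcal{F}_0(H,B,M)$, the output $\hat x$ of Minibatch AC-SA (with suitably chosen parameters, in the heterogeneous intermittent communication setting) has suboptimality at most $$\mathbb{E}F(\hat x)-F^*\le c\left(\frac{HB^2}{R^2}+\min\left\{\frac{\sigma B}{\sqrt{MKR}},\ HB^2\right\}\right).$$
   Context: $\mathcal{F}_0(H,B)$: convex, $H$-smooth (gradient $H$-Lipschitz) functions $F:\mathbb{R}^d\to\mathbb{R}$, $d\in\mathbb N$, with a minimizer $x^*$, $\|x^*\|\le B$. $\mathcal{F}_0(H,B,M)$: all objectives $F(x)=\frac1M\sum_{m=1}^MF_m(x)$ with $F\in\mathcal{F}_0(H,B)$ (no assumption on the individual components beyond differentiability). $F^*=\min F$. Heterogeneous intermittent communication setting: $M$ machines, $R$ rounds of communication, $K$ oracle queries per machine per round; each query of machine $m$ at $x$ returns an independent stochastic gradient with mean $\nabla F_m(x)$ and variance $\mathbb{E}\|\cdot-\nabla F_m(x)\|^2\le\sigma^2$. Minibatch AC-SA: $x^{\mathrm{ag}}_0=x_0=0$; for $t=0,\dots,R-1$: $x^{\mathrm{md}}_{t+1}=\beta_t^{-1}x_t+(1-\beta_t^{-1})x^{\mathrm{ag}}_t$; $x_{t+1}=x_t-\gamma_t\bar g_t$, where $\bar g_t$ is the average of the $MK$ stochastic gradients computed in round $t$ at the point $x^{\mathrm{md}}_{t+1}$ ($K$ on each of the $M$ machines); $x^{\mathrm{ag}}_{t+1}=\beta_t^{-1}x_{t+1}+(1-\beta_t^{-1})x^{\mathrm{ag}}_t$;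 output $\hat x=x^{\mathrm{ag}}_R$. The parameters $\beta_t\ge1$, $\gamma_t\ge0$ may depend on $H,B,\sigma,M,K,R$. *)

theory Defs
  imports "HOL-Probability.Probability"
begin

text \<open>
  The constant in the theorem must not depend on the dimension, so the dimension \<open>d\<close> is a natural
  number that can be quantified inside the formula, not a type. A point of \<open>d\<close>-dimensional
  Euclidean space is a function on \<open>{..<d}\<close> that is \<open>undefined\<close> elsewhere
  (an element of \<open>{..<d} \<rightarrow>\<^sub>E UNIV\<close>), and its Euclidean norm is \<open>L2_set x {..<d}\<close>.
\<close>

type_synonym rvec = "nat \<Rightarrow> real"

definition euclid :: "nat \<Rightarrow> rvec measure" where
  "euclid d = (\<Pi>\<^sub>M i\<in>{..<d}. borel)"

abbreviation points :: "nat \<Rightarrow> rvec set" where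
  "points d \<equiv> {..<d} \<rightarrow>\<^sub>E UNIV"

definition zero_v :: "nat \<Rightarrow> rvec" where
  "zero_v d = (\<lambda>i\<in>{..<d}. 0)"

definition lincomb :: "nat \<Rightarrow> real \<Rightarrow> rvec \<Rightarrow> real \<Rightarrow> rvec \<Rightarrow> rvec" where
  "lincomb d a x b y = (\<lambda>i\<in>{..<d}. a * x i + b * y i)"

definition dist_v :: "nat \<Rightarrow> rvec \<Rightarrow> rvec \<Rightarrow> real" where
  "dist_v d x y = L2_set (\<lambda>i. x i - y i) {..<d}"

text \<open>Frechet differentiability, spelled out because \<open>rvec\<close> is not a normed vector space.\<close>

definition has_gradient :: "nat \<Rightarrow> (rvec \<Rightarrow> real) \<Rightarrow> rvec \<Rightarrow> rvec \<Rightarrow> bool" where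
  "has_gradient d f g x \<longleftrightarrow> g \<in> points d \<and>
     (\<forall>\<epsilon>>0. \<exists>\<delta>>0. \<forall>y\<in>points d. dist_v d y x < \<delta> \<longrightarrow>
        \<bar>f y - f x - (\<Sum>i<d. g i * (y i - x i))\<bar> \<le> \<epsilon> * dist_v d y x)"

definition differentiable_v :: "nat \<Rightarrow> (rvec \<Rightarrow> real) \<Rightarrow> bool" where
  "differentiable_v d f \<longleftrightarrow> (\<forall>x\<in>points d. \<exists>g. has_gradient d f g x)"

definition gradient :: "nat \<Rightarrow> (rvec \<Rightarrow> real) \<Rightarrow> rvec \<Rightarrow> rvec" where
  "gradient d f x = (THE g. has_gradient d f g x)"

definition convex_v :: "nat \<Rightarrow> (rvec \<Rightarrow> real) \<Rightarrow> bool" where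
  "convex_v d f \<longleftrightarrow> (\<forall>x\<in>points d. \<forall>y\<in>points d. \<forall>u\<in>{0..1}.
     f (lincomb d (1 - u) x u y) \<le> (1 - u) * f x + u * f y)"

definition smooth_v :: "nat \<Rightarrow> real \<Rightarrow> (rvec \<Rightarrow> real) \<Rightarrow> bool" where
  "smooth_v d H f \<longleftrightarrow> differentiable_v d f \<and>
     (\<forall>x\<in>points d. \<forall>y\<in>points d. dist_v d (gradient d f x) (gradient d f y) \<le> H * dist_v d x y)"

definition F0 :: "nat \<Rightarrow> real \<Rightarrow> real \<Rightarrow> (rvec \<Rightarrow> real) set" where
  "F0 d H B = {f. convex_v d f \<and> smooth_v d H f \<and>
     (\<exists>xs. is_arg_min f (\<lambda>x. x \<in> points d) xs \<and> L2_set xs {..<d} \<le> B)}"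

definition avg_obj :: "nat \<Rightarrow> (nat \<Rightarrow> rvec \<Rightarrow> real) \<Rightarrow> rvec \<Rightarrow> real" where
  "avg_obj M Fs x = (1 / real M) * (\<Sum>m<M. Fs m x)"

text \<open>Heterogeneous objectives, represented by their families of components.\<close>

definition F0_het :: "nat \<Rightarrow> real \<Rightarrow> real \<Rightarrow> nat \<Rightarrow> (nat \<Rightarrow> rvec \<Rightarrow> real) set" where
  "F0_het d H B M = {Fs. (\<forall>m<M. differentiable_v d (Fs m)) \<and> avg_obj M Fs \<in> F0 d H B}"

text \<open>The minimum value; for members of \<open>F0 d H B\<close> the infimum is attained.\<close>

definition min_val :: "nat \<Rightarrow> (rvec \<Rightarrow> real) \<Rightarrow> real" where
  "min_val d f = (INF x\<in>points d. f x)"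

text \<open>
  \<open>Q m t k x\<close> is the law of the answer to the \<open>k\<close>-th query of machine \<open>m\<close> in round \<open>t\<close> when the
  query point is \<open>x\<close>. Answers to different queries need not be identically distributed.
  Describing the oracle by Markov kernels, instead of random variables on some sample space, keeps
  a type of outcomes out of the statement, on which the universal constant might otherwise depend.
\<close>

type_synonym stoch_oracle = "nat \<Rightarrow> nat \<Rightarrow> nat \<Rightarrow> rvec \<Rightarrow> rvec measure"

definition gradient_oracle ::
  "nat \<Rightarrow> real \<Rightarrow> nat \<Rightarrow> nat \<Rightarrow> nat \<Rightarrow> (nat \<Rightarrow> rvec \<Rightarrow> real) \<Rightarrow> stoch_oracle \<Rightarrow> bool" where
  "gradient_oracle d \<sigma> M K R Fs Q \<longleftrightarrow> (\<forall>m<M. \<forall>t<R. \<forall>k<K.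
     Q m t k \<in> euclid d \<rightarrow>\<^sub>M prob_algebra (euclid d) \<and>
     (\<forall>x\<in>points d.
        (\<forall>i<d. has_bochner_integral (Q m t k x) (\<lambda>g. g i) (gradient d (Fs m) x i)) \<and>
        (\<integral>\<^sup>+ g. ennreal ((dist_v d g (gradient d (Fs m) x))\<^sup>2) \<partial>Q m t k x) \<le> ennreal (\<sigma>\<^sup>2)))"

definition acsa_md :: "nat \<Rightarrow> real \<Rightarrow> rvec \<times> rvec \<Rightarrow> rvec" where
  "acsa_md d b = (\<lambda>(x, xag). lincomb d (1 / b) x (1 - 1 / b) xag)"

definition minibatch_avg :: "nat \<Rightarrow> nat \<Rightarrow> nat \<Rightarrow> (nat \<times> nat \<Rightarrow> rvec) \<Rightarrow> rvec" where
  "minibatch_avg d M K g =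
     (\<lambda>i\<in>{..<d}. (1 / real (M * K)) * (\<Sum>q\<in>{..<M} \<times> {..<K}. g q i))"

definition acsa_update :: "nat \<Rightarrow> real \<Rightarrow> real \<Rightarrow> rvec \<times> rvec \<Rightarrow> rvec \<Rightarrow> rvec \<times> rvec" where
  "acsa_update d b \<eta> = (\<lambda>(x, xag) gbar.
     let x' = lincomb d 1 x (- \<eta>) gbar
     in (x', lincomb d (1 / b) x' (1 - 1 / b) xag))"

text \<open>
  The joint law of the iterates \<open>(x\<^sub>t, x\<^sup>a\<^sup>g\<^sub>t)\<close>. In each round the \<open>M * K\<close> answers are drawn from the
  product measure, i.e. independently of each other given the common query point and with fresh
  randomness in every round.
\<close>

primrec acsa_law ::
  "nat \<Rightarrow> nat \<Rightarrow> nat \<Rightarrow> (nat \<Rightarrow> real) \<Rightarrow> (nat \<Rightarrow> real) \<Rightarrow> stoch_oracle \<Rightarrow> nat \<Rightarrow> (rvec \<times> rvec) measure"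
where
  "acsa_law d M K \<beta> \<gamma> Q 0 = return (euclid d \<Otimes>\<^sub>M euclid d) (zero_v d, zero_v d)"
| "acsa_law d M K \<beta> \<gamma> Q (Suc t) =
     acsa_law d M K \<beta> \<gamma> Q t \<bind> (\<lambda>s.
       distr (\<Pi>\<^sub>M q\<in>{..<M} \<times> {..<K}. Q (fst q) t (snd q) (acsa_md d (\<beta> t) s))
         (euclid d \<Otimes>\<^sub>M euclid d)
         (\<lambda>g. acsa_update d (\<beta> t) (\<gamma> t) s (minibatch_avg d M K g)))"

definition acsa_output ::
  "nat \<Rightarrow> nat \<Rightarrow> nat \<Rightarrow> nat \<Rightarrow> (nat \<Rightarrow> real) \<Rightarrow> (nat \<Rightarrow> real) \<Rightarrow> stoch_oracle \<Rightarrow> rvec measure" where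
  "acsa_output d M K R \<beta> \<gamma> Q = distr (acsa_law d M K \<beta> \<gamma> Q R) (euclid d) snd"

end

theory Submission imports Defs begin

text \<open>
  Write \<open>s\<^sup>2 = \<sigma>\<^sup>2 / (M K)\<close> for the variance of the averaged gradient. Smoothness at the query point,
  applied along \<open>x\<^sup>a\<^sup>g\<^sub>t\<^sub>+\<^sub>1 - x\<^sup>m\<^sup>d\<^sub>t\<^sub>+\<^sub>1 = - (\<gamma>\<^sub>t / \<beta>\<^sub>t) g\<close>, and convexity towards \<open>x\<^sup>*\<close> and \<open>x\<^sup>a\<^sup>g\<^sub>t\<close> give,
  as long as \<open>H \<gamma>\<^sub>t \<le> \<beta>\<^sub>t\<close>, that the conditional expectation of
  \<open>\<gamma>\<^sub>t \<beta>\<^sub>t (F(x\<^sup>a\<^sup>g\<^sub>t\<^sub>+\<^sub>1) - F\<^sup>*) + |x\<^sub>t\<^sub>+\<^sub>1 - x\<^sup>*|\<^sup>2 / 2\<close> is at most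
  \<open>\<gamma>\<^sub>t (\<beta>\<^sub>t - 1) (F(x\<^sup>a\<^sup>g\<^sub>t) - F\<^sup>*) + |x\<^sub>t - x\<^sup>*|\<^sup>2 / 2 + \<gamma>\<^sub>t\<^sup>2 s\<^sup>2\<close>. With \<open>\<beta>\<^sub>t = (t + 2) / 2\<close> and
  \<open>\<gamma>\<^sub>t = \<gamma> (t + 2) / 2\<close> this telescopes to a bound
  \<open>2 B\<^sup>2 / (\<gamma> (R + 1)\<^sup>2) + \<gamma> s\<^sup>2 R\<close>, and \<open>\<gamma> = 1 / (H + s R\<^sup>3\<^sup>/\<^sup>2 / B)\<close> balances its two terms.
  When the noise term exceeds \<open>H B\<^sup>2\<close>, the step size \<open>0\<close> is good enough, because already
  \<open>F(0) - F\<^sup>* \<le> H B\<^sup>2 / 2\<close>. All integrals of the potential are nonnegative Lebesgue integrals, so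
  integrability of the iterates need not be carried through the recursion.
\<close>

subsection \<open>Gradients, convexity and smoothness\<close>

lemma dist_v_sq: "(dist_v d x y)\<^sup>2 = (\<Sum>i<d. (x i - y i)\<^sup>2)"
  by (simp add: dist_v_def L2_set_def sum_nonneg)

lemma lincomb_in_points [simp, intro]: "lincomb d a x b y \<in> points d"
  by (auto simp: lincomb_def)

lemma lincomb_apply [simp]: "i < d \<Longrightarrow> lincomb d a x b y i = a * x i + b * y i"
  by (simp add: lincomb_def)

lemma points_eqI: "x \<in> points d \<Longrightarrow> y \<in> points d \<Longrightarrow> (\<And>i. i < d \<Longrightarrow> x i = y i) \<Longrightarrow> x = y"
  by (erule (1) PiE_ext) auto

lemma lincomb_move_zero: "x \<in> points d \<Longrightarrow> lincomb d 1 x 0 v = x"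
  by (rule points_eqI[where d = d]) simp_all

lemma has_gradientD:
  assumes "has_gradient d f g x" "\<epsilon> > 0"
  shows "\<exists>\<delta>>0. \<forall>y\<in>points d. dist_v d y x < \<delta> \<longrightarrow>
    \<bar>f y - f x - (\<Sum>i<d. g i * (y i - x i))\<bar> \<le> \<epsilon> * dist_v d y x"
  using assms by (simp add: has_gradient_def)

lemma dist_v_move: "dist_v d (lincomb d 1 x h v) x = \<bar>h\<bar> * L2_set v {..<d}"
proof -
  have "dist_v d (lincomb d 1 x h v) x = sqrt (h\<^sup>2 * (\<Sum>i<d. (v i)\<^sup>2))"
    by (simp add: dist_v_def L2_set_def sum_distrib_left power_mult_distrib)
  then show ?thesis by (simp add: real_sqrt_mult L2_set_def)
qed

text \<open>Reduces \<open>has_gradient\<close> to one-variable derivatives along lines, so that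
  real calculus becomes available on \<open>rvec\<close>. Moving by \<open>h\<close> along
  \<open>v\<close> changes the distance by \<open>\<bar>h\<bar>\<close> times the norm of
  \<open>v\<close>, which turns the Frechet error bound into one for the difference
  quotient.\<close>

lemma has_gradient_directional:
  assumes g: "has_gradient d f g x" and x: "x \<in> points d"
  shows "((\<lambda>u. f (lincomb d 1 x u v)) has_real_derivative (\<Sum>i<d. g i * v i)) (at 0)"
proof -
  define D N where "D = (\<Sum>i<d. g i * v i)" and "N = L2_set v {..<d}"
  have N: "N \<ge> 0" by (simp add: N_def)
  have "((\<lambda>h. (f (lincomb d 1 x h v) - f x) / h) \<longlongrightarrow> D) (at 0)"
  proof (rule LIM_I)
    fix e :: real assume e: "e > 0"
    \<comment> \<open>The summand 1 keeps the quotient defined when \<open>v\<close> has norm 0 and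
      makes \<open>\<epsilon> * N < e\<close> strict.\<close>
    define \<epsilon> where "\<epsilon> = e / (N + 1)"
    have \<epsilon>: "\<epsilon> > 0" using e N by (simp add: \<epsilon>_def)
    obtain \<delta> where \<delta>: "\<delta> > 0" and b: "\<And>y. y \<in> points d \<Longrightarrow> dist_v d y x < \<delta> \<Longrightarrow>
        \<bar>f y - f x - (\<Sum>i<d. g i * (y i - x i))\<bar> \<le> \<epsilon> * dist_v d y x"
      using has_gradientD[OF g \<epsilon>] by metis
    have "norm ((f (lincomb d 1 x h v) - f x) / h - D) < e" if h: "h \<noteq> 0" "\<bar>h\<bar> < \<delta> / (N + 1)" for h
    proof -
      have "\<bar>h\<bar> * N \<le> \<bar>h\<bar> * (N + 1)" by (simp add: mult_left_mono)
      also have "\<dots> < \<delta>" using h N by (simp add: pos_less_divide_eq)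
      finally have "\<bar>f (lincomb d 1 x h v) - f x - (\<Sum>i<d. g i * (h * v i))\<bar> \<le> \<epsilon> * (\<bar>h\<bar> * N)"
        using b[of "lincomb d 1 x h v"] by (simp add: dist_v_move N_def)
      moreover have "(\<Sum>i<d. g i * (h * v i)) = h * D"
        by (simp add: D_def sum_distrib_left mult_ac)
      ultimately have "\<bar>f (lincomb d 1 x h v) - f x - h * D\<bar> \<le> (\<epsilon> * N) * \<bar>h\<bar>"
        by (simp add: mult_ac)
      also have "\<dots> < e * \<bar>h\<bar>"
        using h e N by (intro mult_strict_right_mono) (auto simp: \<epsilon>_def field_simps)
      finally have "\<bar>(f (lincomb d 1 x h v) - f x - h * D) / h\<bar> < e"
        using h by (simp add: pos_divide_less_eq)
      then show ?thesis using h by (simp add: diff_divide_distrib)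
    qed
    then show "\<exists>s>0. \<forall>h. h \<noteq> 0 \<and> norm (h - 0) < s \<longrightarrow>
        norm ((f (lincomb d 1 x h v) - f x) / h - D) < e"
      using \<delta> N by (intro exI[of _ "\<delta> / (N + 1)"]) auto
  qed
  then show ?thesis
    unfolding has_field_derivative_iff by (simp add: lincomb_move_zero[OF x] D_def)
qed

lemma has_gradient_along_line:
  assumes "has_gradient d f g (lincomb d 1 x u v)"
  shows "((\<lambda>u. f (lincomb d 1 x u v)) has_real_derivative (\<Sum>i<d. g i * v i)) (at u)"
proof -
  have "lincomb d 1 (lincomb d 1 x u v) h v = lincomb d 1 x (h + u) v" for h
    by (rule points_eqI[where d = d]) (simp_all add: algebra_simps)
  with has_gradient_directional[OF assms, of v]
  show ?thesis using DERIV_shift[of "\<lambda>u. f (lincomb d 1 x u v)" _ 0 u] by simp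
qed

text \<open>Directional derivatives along the unit vectors determine each coordinate, and membership
  in \<open>points d\<close> settles the coordinates outside \<open>{..<d}\<close>. This is what
  makes the \<open>THE\<close> in \<open>gradient\<close> meaningful.\<close>

lemma has_gradient_unique:
  assumes "has_gradient d f g x" "has_gradient d f g' x" "x \<in> points d"
  shows "g = g'"
proof (rule points_eqI)
  show "g \<in> points d" "g' \<in> points d" using assms by (auto simp: has_gradient_def)
  fix j assume j: "j < d"
  have "(\<Sum>i<d. h i * (if i = j then 1 else 0)) = h j" for h :: "nat \<Rightarrow> real"
    using j by (simp add: if_distrib cong: if_cong)
  with DERIV_unique[OF assms(1,2)[THEN has_gradient_directional, OF assms(3), of "\<lambda>i. if i = j then 1 else 0"]]
  show "g j = g' j" by simp
qed

lemma gradient_eq: "has_gradient d f g x \<Longrightarrow> x \<in> points d \<Longrightarrow> gradient d f x = g"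
  unfolding gradient_def by (blast intro: has_gradient_unique)

lemma differentiable_has_gradient:
  "differentiable_v d f \<Longrightarrow> x \<in> points d \<Longrightarrow> has_gradient d f (gradient d f x) x"
  unfolding differentiable_v_def by (metis gradient_eq)

lemma has_gradient_zero: "has_gradient d (\<lambda>x. 0) (\<lambda>i\<in>{..<d}. 0) x"
  unfolding has_gradient_def by (auto simp: dist_v_def intro!: exI[of _ 1])

lemma has_gradient_lincomb:
  assumes "has_gradient d f g x" "has_gradient d f' g' x"
  shows "has_gradient d (\<lambda>y. a * f y + b * f' y) (lincomb d a g b g') x"
  unfolding has_gradient_def
proof (intro conjI allI impI lincomb_in_points)
  fix e :: real assume e: "e > 0"
  \<comment> \<open>Each of the two errors is scaled by its coefficient; the summand 1 covers
    \<open>a = b = 0\<close>.\<close>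
  define \<epsilon> where "\<epsilon> = e / (\<bar>a\<bar> + \<bar>b\<bar> + 1)"
  have \<epsilon>: "\<epsilon> > 0" "(\<bar>a\<bar> + \<bar>b\<bar>) * \<epsilon> \<le> e"
    using e by (auto simp: \<epsilon>_def field_simps)
  obtain \<delta> where \<delta>: "\<delta> > 0" "\<And>y. y \<in> points d \<Longrightarrow> dist_v d y x < \<delta> \<Longrightarrow>
        \<bar>f y - f x - (\<Sum>i<d. g i * (y i - x i))\<bar> \<le> \<epsilon> * dist_v d y x"
    using has_gradientD[OF assms(1) \<epsilon>(1)] by metis
  obtain \<delta>' where \<delta>': "\<delta>' > 0" "\<And>y. y \<in> points d \<Longrightarrow> dist_v d y x < \<delta>' \<Longrightarrow>
        \<bar>f' y - f' x - (\<Sum>i<d. g' i * (y i - x i))\<bar> \<le> \<epsilon> * dist_v d y x"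
    using has_gradientD[OF assms(2) \<epsilon>(1)] by metis
  have "\<bar>(a * f y + b * f' y) - (a * f x + b * f' x) - (\<Sum>i<d. lincomb d a g b g' i * (y i - x i))\<bar>
      \<le> e * dist_v d y x" if y: "y \<in> points d" "dist_v d y x < min \<delta> \<delta>'" for y
  proof -
    have "(\<Sum>i<d. lincomb d a g b g' i * (y i - x i)) =
        a * (\<Sum>i<d. g i * (y i - x i)) + b * (\<Sum>i<d. g' i * (y i - x i))"
      by (simp add: sum_distrib_left flip: sum.distrib) (rule sum.cong, auto simp: algebra_simps)
    then have "\<bar>(a * f y + b * f' y) - (a * f x + b * f' x) - (\<Sum>i<d. lincomb d a g b g' i * (y i - x i))\<bar>
        = \<bar>a * (f y - f x - (\<Sum>i<d. g i * (y i - x i))) + b * (f' y - f' x - (\<Sum>i<d. g' i * (y i - x i)))\<bar>"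
      by (simp add: algebra_simps)
    also have "\<dots> \<le> \<bar>a\<bar> * (\<epsilon> * dist_v d y x) + \<bar>b\<bar> * (\<epsilon> * dist_v d y x)"
      unfolding abs_mult[symmetric]
      using mult_left_mono[OF \<delta>(2)[OF y(1)], of "\<bar>a\<bar>"] mult_left_mono[OF \<delta>'(2)[OF y(1)], of "\<bar>b\<bar>"] y(2)
      by (intro order_trans[OF abs_triangle_ineq] add_mono) (simp_all add: abs_mult)
    also have "\<dots> = ((\<bar>a\<bar> + \<bar>b\<bar>) * \<epsilon>) * dist_v d y x" by (simp add: algebra_simps)
    also have "\<dots> \<le> e * dist_v d y x"
      using \<epsilon>(2) by (intro mult_right_mono) (auto simp: dist_v_def)
    finally show ?thesis .
  qed
  then show "\<exists>\<delta>>0. \<forall>y\<in>points d. dist_v d y x < \<delta> \<longrightarrow>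
        \<bar>(a * f y + b * f' y) - (a * f x + b * f' x) - (\<Sum>i<d. lincomb d a g b g' i * (y i - x i))\<bar>
        \<le> e * dist_v d y x"
    using \<delta>(1) \<delta>'(1) by (intro exI[of _ "min \<delta> \<delta>'"]) auto
qed

lemma has_gradient_avg_obj:
  assumes "\<And>m. m < M \<Longrightarrow> has_gradient d (Fs m) (g m) x"
  shows "has_gradient d (avg_obj M Fs) (\<lambda>i\<in>{..<d}. (1 / real M) * (\<Sum>m<M. g m i)) x"
proof -
  have "has_gradient d (\<lambda>y. \<Sum>m<n. Fs m y) (\<lambda>i\<in>{..<d}. \<Sum>m<n. g m i) x" if "n \<le> M" for n
    using that
  proof (induction n)
    case 0
    then show ?case using has_gradient_zero[of d x] by (simp add: restrict_def)
  next
    case (Suc n)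
    have "lincomb d 1 (\<lambda>i\<in>{..<d}. \<Sum>m<n. g m i) 1 (g n) = (\<lambda>i\<in>{..<d}. \<Sum>m<Suc n. g m i)"
      by (rule points_eqI[where d = d]) simp_all
    with has_gradient_lincomb[OF Suc.IH assms[of n], of 1 1] Suc.prems show ?case
      by (simp del: restrict_apply)
  qed
  \<comment> \<open>Scaling by \<open>1 / real M\<close> is obtained as a linear combination with
    the zero function.\<close>
  from has_gradient_lincomb[OF this[OF order_refl] has_gradient_zero, of "1 / real M" 0]
  have "has_gradient d (avg_obj M Fs)
      (lincomb d (1 / real M) (\<lambda>i\<in>{..<d}. \<Sum>m<M. g m i) 0 (\<lambda>i\<in>{..<d}. 0)) x"
    by (simp add: avg_obj_def[abs_def])
  also have "lincomb d (1 / real M) (\<lambda>i\<in>{..<d}. \<Sum>m<M. g m i) 0 (\<lambda>i\<in>{..<d}. 0) =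
      (\<lambda>i\<in>{..<d}. (1 / real M) * (\<Sum>m<M. g m i))"
    by (rule points_eqI[where d = d]) simp_all
  finally show ?thesis .
qed

text \<open>Unbiasedness of the minibatch: the right-hand side is the mean of the average of all
  \<open>M * K\<close> answers. Each component gradient occurs \<open>K\<close> times, once per
  query, and the factor \<open>K\<close> cancels.\<close>

lemma gradient_avg_obj:
  assumes diff: "\<And>m. m < M \<Longrightarrow> differentiable_v d (Fs m)" and K: "K \<ge> 1"
    and x: "x \<in> points d" and i: "i < d"
  shows "gradient d (avg_obj M Fs) x i =
    (1 / real (M * K)) * (\<Sum>q\<in>{..<M} \<times> {..<K}. gradient d (Fs (fst q)) x i)"
proof -
  have "gradient d (avg_obj M Fs) x = (\<lambda>i\<in>{..<d}. (1 / real M) * (\<Sum>m<M. gradient d (Fs m) x i))"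
    by (intro gradient_eq has_gradient_avg_obj differentiable_has_gradient diff x)
  moreover have "(\<Sum>q\<in>{..<M} \<times> {..<K}. gradient d (Fs (fst q)) x i) = real K * (\<Sum>m<M. gradient d (Fs m) x i)"
    by (simp add: sum.cartesian_product' sum_distrib_left)
  ultimately show ?thesis using K i by simp
qed

section \<open>First-order inequalities from convexity and smoothness, and measurability of the
  objective\<close>

lemma convex_gradient_below:
  assumes f: "convex_v d f" and g: "has_gradient d f g x" and x: "x \<in> points d" and y: "y \<in> points d"
  shows "f x + (\<Sum>i<d. g i * (y i - x i)) \<le> f y"
proof (rule ccontr)
  define v where "v = (\<lambda>i. y i - x i)"
  \<comment> \<open>\<open>\<psi>\<close> is \<open>f\<close> along the segment minus the slope of
    its chord. If the claim failed, \<open>\<psi>\<close> would have positive derivative at 0 and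
    rise above \<open>\<psi> 0\<close>, whereas convexity keeps it at or below
    \<open>\<psi> 0\<close> on the unit interval.\<close>
  define \<psi> where "\<psi> u = f (lincomb d 1 x u v) - u * (f y - f x)" for u
  assume "\<not> ?thesis"
  then have pos: "(\<Sum>i<d. g i * v i) - (f y - f x) > 0" by (simp add: v_def)
  have "(\<psi> has_real_derivative (\<Sum>i<d. g i * v i) - (f y - f x)) (at 0)"
    unfolding \<psi>_def by (auto intro!: derivative_eq_intros has_gradient_directional[OF g x])
  from DERIV_pos_inc_right[OF this pos] obtain \<delta> where \<delta>: "\<delta> > 0"
    and inc: "\<And>h. 0 < h \<Longrightarrow> h < \<delta> \<Longrightarrow> \<psi> 0 < \<psi> (0 + h)" by blast
  define h where "h = min 1 (\<delta> / 2)"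
  have h: "0 < h" "h < \<delta>" "h \<le> 1" using \<delta> by (auto simp: h_def)
  have "lincomb d (1 - h) x h y = lincomb d 1 x h v"
    by (rule points_eqI[where d = d]) (simp_all add: v_def algebra_simps)
  then have "f (lincomb d 1 x h v) \<le> (1 - h) * f x + h * f y"
    using f x y h unfolding convex_v_def by (metis atLeastAtMost_iff less_imp_le)
  then have "\<psi> h \<le> \<psi> 0"
    using lincomb_move_zero[OF x, of v] by (simp add: \<psi>_def algebra_simps)
  with inc[OF h(1,2)] show False by simp
qed

text \<open>The descent lemma, proved by monotonicity instead of integrating the gradient. Along the
  segment, \<open>\<psi>\<close> subtracts the linear and quadratic terms from \<open>f\<close>;
  Cauchy-Schwarz and the Lipschitz bound make its derivative nonpositive on the unit
  interval.\<close>

lemma smooth_quadratic_upper: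
  assumes f: "smooth_v d H f" and x: "x \<in> points d" and y: "y \<in> points d"
  shows "f y \<le> f x + (\<Sum>i<d. gradient d f x i * (y i - x i)) + H / 2 * (dist_v d y x)\<^sup>2"
proof -
  define v where "v = (\<lambda>i. y i - x i)"
  define N where "N = L2_set v {..<d}"
  define z where "z u = lincomb d 1 x u v" for u
  define D where "D u = (\<Sum>i<d. gradient d f (z u) i * v i)" for u
  define \<psi> where "\<psi> u = f (z u) - u * D 0 - H / 2 * u\<^sup>2 * N\<^sup>2" for u
  have diff: "differentiable_v d f"
    and lip: "\<And>x y. x \<in> points d \<Longrightarrow> y \<in> points d \<Longrightarrow>
      dist_v d (gradient d f x) (gradient d f y) \<le> H * dist_v d x y"
    using f by (auto simp: smooth_v_def)
  have z0: "z 0 = x" by (simp add: z_def lincomb_move_zero[OF x])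
  have z1: "z 1 = y" unfolding z_def by (rule points_eqI[OF lincomb_in_points y]) (simp add: v_def)
  have "\<psi> 1 \<le> \<psi> 0"
  proof (rule DERIV_nonpos_imp_nonincreasing[of 0 1 \<psi>])
    fix u :: real assume u: "0 \<le> u" "u \<le> 1"
    have "(\<psi> has_real_derivative D u - D 0 - H * u * N\<^sup>2) (at u)"
      unfolding \<psi>_def z_def
      by (auto intro!: derivative_eq_intros has_gradient_along_line
          differentiable_has_gradient[OF diff lincomb_in_points] simp: D_def z_def)
    moreover have "D u - D 0 \<le> H * u * N\<^sup>2"
    proof -
      have "D u - D 0 = (\<Sum>i<d. (gradient d f (z u) i - gradient d f (z 0) i) * v i)"
        by (simp add: D_def algebra_simps sum_subtractf)
      also have "\<dots> \<le> (\<Sum>i<d. \<bar>gradient d f (z u) i - gradient d f (z 0) i\<bar> * \<bar>v i\<bar>)"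
        by (intro sum_mono) (metis abs_ge_self abs_mult)
      also have "\<dots> \<le> dist_v d (gradient d f (z u)) (gradient d f (z 0)) * N"
        unfolding dist_v_def N_def by (rule L2_set_mult_ineq)
      also have "\<dots> \<le> (H * dist_v d (z u) (z 0)) * N"
        by (intro mult_right_mono lip) (simp_all add: z_def N_def)
      also have "dist_v d (z u) (z 0) = u * N"
        using u dist_v_move[of d x u v] unfolding z0 by (simp add: z_def N_def)
      finally show ?thesis by (simp add: power2_eq_square mult_ac)
    qed
    ultimately show "\<exists>y. (\<psi> has_real_derivative y) (at u) \<and> y \<le> 0" by force
  qed simp
  then show ?thesis
    using dist_v_move[of d x 1 v] z1[unfolded z_def] by (simp add: \<psi>_def z0 z1 D_def N_def) (simp add: v_def)
qed

text \<open>\<open>euclid d\<close> is a product sigma-algebra on extensional functions, so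
  continuity is shown for an extension of \<open>f\<close> to all sequences: \<open>r\<close>
  forgets the coordinates from \<open>d\<close> on. The tangent below and the quadratic above
  squeeze \<open>f (r y)\<close> to \<open>f (r z)\<close>, and both depend on finitely many
  coordinates, hence are continuous in the product topology.\<close>

lemma convex_smooth_borel_measurable:
  assumes cf: "convex_v d f" and sf: "smooth_v d H f"
  shows "f \<in> borel_measurable (euclid d)"
proof -
  define r :: "rvec \<Rightarrow> rvec" where "r z = (\<lambda>i\<in>{..<d}. z i)" for z
  define G where "G z = gradient d f (r z)" for z
  have r: "r z \<in> points d" for z by (simp add: r_def)
  have diff: "differentiable_v d f" using sf by (simp add: smooth_v_def)
  have "isCont (\<lambda>z. f (r z)) z" for z
  proof -
    define l where "l y = (\<Sum>i<d. G z i * (y i - z i))" for y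
    define q where "q y = (\<Sum>i<d. (y i - z i)\<^sup>2)" for y
    have lower: "f (r z) + l y \<le> f (r y)" for y
      using convex_gradient_below[OF cf differentiable_has_gradient[OF diff r] r r, of z y]
      by (simp add: l_def G_def r_def)
    have upper: "f (r y) \<le> f (r z) + l y + H / 2 * q y" for y
      using smooth_quadratic_upper[OF sf r r, of y z]
      by (simp add: l_def G_def r_def q_def dist_v_sq)
    have coord: "((\<lambda>y. y i) \<longlongrightarrow> z i) (at z)" for i
      using continuous_on_product_coordinates[of i]
      by (auto simp: continuous_on_def)
    have "(l \<longlongrightarrow> (\<Sum>i<d. G z i * (z i - z i))) (at z)"
      unfolding l_def by (intro tendsto_intros coord)
    moreover have "(q \<longlongrightarrow> (\<Sum>i<d. (z i - z i)\<^sup>2)) (at z)"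
      unfolding q_def by (intro tendsto_intros coord)
    ultimately have lq: "(l \<longlongrightarrow> 0) (at z)" "(q \<longlongrightarrow> 0) (at z)" by simp_all
    have "((\<lambda>y. f (r y)) \<longlongrightarrow> f (r z)) (at z)"
    proof (rule tendsto_sandwich)
      show "((\<lambda>y. f (r z) + l y) \<longlongrightarrow> f (r z)) (at z)"
        by (rule tendsto_eq_intros lq refl | simp)+
      show "((\<lambda>y. f (r z) + l y + H / 2 * q y) \<longlongrightarrow> f (r z)) (at z)"
        by (rule tendsto_eq_intros lq refl | simp)+
    qed (intro always_eventually allI lower upper)+
    then show ?thesis by (simp add: isCont_def)
  qed
  then have "(\<lambda>z. f (r z)) \<in> borel_measurable borel"
    by (intro borel_measurable_continuous_onI) (simp add: continuous_at_imp_continuous_on)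
  \<comment> \<open>Extension by zero maps \<open>euclid d\<close> measurably into the sequences,
    and \<open>r\<close> undoes it on \<open>points d\<close>.\<close>
  moreover have "(\<lambda>x i. if i < d then x i else 0) \<in> borel_measurable (euclid d)"
  proof (rule measurable_coordinatewise_then_product)
    show "(\<lambda>x. if i < d then x i else 0) \<in> borel_measurable (euclid d)" for i
      unfolding euclid_def by (cases "i < d") simp_all
  qed
  ultimately have "(\<lambda>x. f (r (\<lambda>i. if i < d then x i else 0))) \<in> borel_measurable (euclid d)"
    by (rule measurable_compose[rotated])
  moreover have "r (\<lambda>i. if i < d then x i else 0) = x" if "x \<in> space (euclid d)" for x
    using that by (intro points_eqI[OF r]) (auto simp: r_def euclid_def space_PiM)
  ultimately show ?thesis
    by (subst (asm) measurable_cong[where g = f]) auto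
qed

subsection \<open>Finite product measures\<close>

text \<open>It suffices to test the kernel on the intersection-stable generator of boxes, where the
  product measure is a finite product of measurable functions of the parameter.\<close>

lemma measurable_PiM_kernel:
  assumes I: "finite I"
    and \<kappa>: "\<And>i. i \<in> I \<Longrightarrow> \<kappa> i \<in> M \<rightarrow>\<^sub>M prob_algebra (N i)"
  shows "(\<lambda>x. \<Pi>\<^sub>M i\<in>I. \<kappa> i x) \<in> M \<rightarrow>\<^sub>M prob_algebra (\<Pi>\<^sub>M i\<in>I. N i)"
proof (rule measurable_prob_algebra_generated[OF sets_PiM Int_stable_prod_algebra prod_algebra_sets_into_space])
  have prob: "prob_space (\<kappa> i x)" and sets: "sets (\<kappa> i x) = sets (N i)" if "x \<in> space M" "i \<in> I" for i x
    using measurable_space[OF \<kappa> that(1)] that(2) by (auto simp: space_prob_algebra)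
  show "prob_space (\<Pi>\<^sub>M i\<in>I. \<kappa> i x)" if "x \<in> space M" for x
    using prob[OF that] by (intro prob_space_PiM)
  show "sets (\<Pi>\<^sub>M i\<in>I. \<kappa> i x) = sets (\<Pi>\<^sub>M i\<in>I. N i)" if "x \<in> space M" for x
    using sets[OF that] by (intro sets_PiM_cong refl)
  fix A assume "A \<in> prod_algebra I N"
  then obtain E where A: "A = Pi\<^sub>E I E" and E: "\<And>i. i \<in> I \<Longrightarrow> E i \<in> sets (N i)"
    unfolding prod_algebra_eq_finite[OF I] by blast
  have "emeasure (\<Pi>\<^sub>M i\<in>I. \<kappa> i x) A = (\<Prod>i\<in>I. emeasure (\<kappa> i x) (E i))" if x: "x \<in> space M" for x
  proof -
    have "prod_emb I (\<lambda>i. \<kappa> i x) I (Pi\<^sub>E I E) = Pi\<^sub>E I E"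
      using E sets[OF x] sets.sets_into_space by (intro prod_emb_PiE_same_index) blast
    with emeasure_PiM_emb[of I "\<lambda>i. \<kappa> i x" I E] show ?thesis
      using prob[OF x] sets[OF x] E I by (simp add: A)
  qed
  moreover have "(\<lambda>x. \<Prod>i\<in>I. emeasure (\<kappa> i x) (E i)) \<in> borel_measurable M"
    by (intro borel_measurable_prod_ennreal measurable_compose[OF measurable_prob_algebraD[OF \<kappa>]]
        measurable_emeasure_subprob_algebra E)
  ultimately show "(\<lambda>x. emeasure (\<Pi>\<^sub>M i\<in>I. \<kappa> i x) A) \<in> borel_measurable M"
    by (subst measurable_cong) auto
qed

text \<open>Independence means that the joint law is the product of the marginal laws. Here the
  joint law of the coordinates is the product measure itself and its marginals are the
  factors.\<close>

lemma indep_vars_PiM_components: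
  assumes \<mu>: "\<And>i. i \<in> I \<Longrightarrow> prob_space (\<mu> i)" and I: "I \<noteq> {}"
  shows "prob_space.indep_vars (\<Pi>\<^sub>M i\<in>I. \<mu> i) \<mu> (\<lambda>i x. x i) I"
proof -
  interpret prob_space "\<Pi>\<^sub>M i\<in>I. \<mu> i" using \<mu> by (rule prob_space_PiM)
  have "distr (\<Pi>\<^sub>M i\<in>I. \<mu> i) (\<Pi>\<^sub>M i\<in>I. \<mu> i) (\<lambda>x. \<lambda>i\<in>I. x i) = (\<Pi>\<^sub>M i\<in>I. \<mu> i)"
    by (subst distr_cong[OF refl refl, where g = "\<lambda>x. x"]) (auto simp: space_PiM distr_id)
  also have "\<dots> = (\<Pi>\<^sub>M i\<in>I. distr (\<Pi>\<^sub>M i\<in>I. \<mu> i) (\<mu> i) (\<lambda>x. x i))"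
    using distr_PiM_component[where M = \<mu> and I = I, OF \<mu>] by (intro PiM_cong) auto
  finally show ?thesis
    by (subst indep_vars_iff_distr_eq_PiM'[OF I]) auto
qed

text \<open>Expanding the square gives a double sum. Off the diagonal, independence yields
  integrability and factors the expectation into a product of zero means; the diagonal is covered by
  square integrability.\<close>

lemma (in prob_space) expectation_square_indep_sum:
  fixes X :: "'i \<Rightarrow> 'a \<Rightarrow> real"
  assumes I: "finite I" and indep: "indep_vars (\<lambda>_. borel) X I"
    and int: "\<And>i. i \<in> I \<Longrightarrow> integrable M (X i)"
    and mean: "\<And>i. i \<in> I \<Longrightarrow> expectation (X i) = 0"
    and sq: "\<And>i. i \<in> I \<Longrightarrow> integrable M (\<lambda>x. (X i x)\<^sup>2)"
  shows "integrable M (\<lambda>x. (\<Sum>i\<in>I. X i x)\<^sup>2)"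
    and "expectation (\<lambda>x. (\<Sum>i\<in>I. X i x)\<^sup>2) = (\<Sum>i\<in>I. expectation (\<lambda>x. (X i x)\<^sup>2))"
proof -
  have eq: "(\<Sum>i\<in>I. X i x)\<^sup>2 = (\<Sum>i\<in>I. \<Sum>j\<in>I. X i x * X j x)" for x
    by (simp add: power2_eq_square sum_product)
  have pair: "integrable M (\<lambda>x. X i x * X j x) \<and>
      expectation (\<lambda>x. X i x * X j x) = (if i = j then expectation (\<lambda>x. (X i x)\<^sup>2) else 0)"
    if ij: "i \<in> I" "j \<in> I" for i j
  proof (cases "i = j")
    case True
    then show ?thesis using sq[OF ij(1)] by (simp add: power2_eq_square)
  next
    case False
    have "indep_vars (\<lambda>_. borel) X {i, j}"
      using ij by (intro indep_vars_subset[OF indep]) auto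
    from indep_vars_lebesgue_integral[OF _ this] indep_vars_integrable[OF _ this] False
    show ?thesis using int mean ij by auto
  qed
  show "integrable M (\<lambda>x. (\<Sum>i\<in>I. X i x)\<^sup>2)"
    unfolding eq using pair by (intro Bochner_Integration.integrable_sum) auto
  have "expectation (\<lambda>x. (\<Sum>i\<in>I. X i x)\<^sup>2) = (\<Sum>i\<in>I. \<Sum>j\<in>I. expectation (\<lambda>x. X i x * X j x))"
    unfolding eq using pair by (subst Bochner_Integration.integral_sum, force)+ auto
  also have "\<dots> = (\<Sum>i\<in>I. expectation (\<lambda>x. (X i x)\<^sup>2))"
    using pair I by (intro sum.cong) simp_all
  finally show "expectation (\<lambda>x. (\<Sum>i\<in>I. X i x)\<^sup>2) = (\<Sum>i\<in>I. expectation (\<lambda>x. (X i x)\<^sup>2))" .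
qed

lemma
  fixes f :: "'a \<Rightarrow> real"
  assumes \<mu>: "\<And>i. i \<in> I \<Longrightarrow> prob_space (\<mu> i)" and i: "i \<in> I"
    and f: "f \<in> borel_measurable (\<mu> i)"
  shows integrable_PiM_component: "integrable (\<Pi>\<^sub>M i\<in>I. \<mu> i) (\<lambda>x. f (x i)) \<longleftrightarrow> integrable (\<mu> i) f"
    and integral_PiM_component: "(\<integral>x. f (x i) \<partial>(\<Pi>\<^sub>M i\<in>I. \<mu> i)) = (\<integral>y. f y \<partial>\<mu> i)"
proof -
  note d = distr_PiM_component[where M = \<mu> and I = I, OF \<mu> i]
  show "integrable (\<Pi>\<^sub>M i\<in>I. \<mu> i) (\<lambda>x. f (x i)) \<longleftrightarrow> integrable (\<mu> i) f"
    using integrable_distr_eq[of "\<lambda>x. x i" "\<Pi>\<^sub>M i\<in>I. \<mu> i" "\<mu> i" f] i f d by simp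
  show "(\<integral>x. f (x i) \<partial>(\<Pi>\<^sub>M i\<in>I. \<mu> i)) = (\<integral>y. f y \<partial>\<mu> i)"
    using integral_distr[of "\<lambda>x. x i" "\<Pi>\<^sub>M i\<in>I. \<mu> i" "\<mu> i" f] i f d by simp
qed

lemma
  fixes f :: "'i \<Rightarrow> 'a \<Rightarrow> real"
  assumes \<mu>: "\<And>i. i \<in> I \<Longrightarrow> prob_space (\<mu> i)" and I: "finite I" "I \<noteq> {}"
    and f: "\<And>i. i \<in> I \<Longrightarrow> has_bochner_integral (\<mu> i) (f i) (m i)"
    and sq: "\<And>i. i \<in> I \<Longrightarrow> integrable (\<mu> i) (\<lambda>y. (f i y - m i)\<^sup>2)"
  shows has_bochner_integral_PiM_sum:
      "has_bochner_integral (\<Pi>\<^sub>M i\<in>I. \<mu> i) (\<lambda>x. \<Sum>i\<in>I. f i (x i)) (\<Sum>i\<in>I. m i)"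
    and has_bochner_integral_PiM_sum_square:
      "has_bochner_integral (\<Pi>\<^sub>M i\<in>I. \<mu> i) (\<lambda>x. (\<Sum>i\<in>I. f i (x i))\<^sup>2)
        ((\<Sum>i\<in>I. m i)\<^sup>2 + (\<Sum>i\<in>I. \<integral>y. (f i y - m i)\<^sup>2 \<partial>\<mu> i))"
proof -
  interpret prob_space "\<Pi>\<^sub>M i\<in>I. \<mu> i" using \<mu> by (rule prob_space_PiM)
  have const: "has_bochner_integral (\<Pi>\<^sub>M i\<in>I. \<mu> i) (\<lambda>_. c) c" for c :: real
    by (simp add: has_bochner_integral_iff prob_space)
  have meas: "f i \<in> borel_measurable (\<mu> i)" if "i \<in> I" for i
    using f[OF that] by (rule borel_measurable_has_bochner_integral)
  have mean: "has_bochner_integral (\<Pi>\<^sub>M i\<in>I. \<mu> i) (\<lambda>x. f i (x i)) (m i)" if "i \<in> I" for i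
    using f[OF that] integrable_PiM_component[where f = "f i" and \<mu> = \<mu> and I = I, OF \<mu> that meas[OF that]]
      integral_PiM_component[where f = "f i" and \<mu> = \<mu> and I = I, OF \<mu> that meas[OF that]]
    by (auto simp: has_bochner_integral_iff)
  then show sum: "has_bochner_integral (\<Pi>\<^sub>M i\<in>I. \<mu> i) (\<lambda>x. \<Sum>i\<in>I. f i (x i)) (\<Sum>i\<in>I. m i)"
    by (rule has_bochner_integral_sum)
  \<comment> \<open>The centered coordinates are independent with mean zero, so their variances
    add.\<close>
  define X where "X i x = f i (x i) - m i" for i x
  have indep: "indep_vars (\<lambda>_. borel) X I"
    unfolding X_def
    by (rule indep_vars_compose2[OF indep_vars_PiM_components[where \<mu> = \<mu> and I = I, OF \<mu> I(2)], where Y = "\<lambda>i y. f i y - m i"])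
      (auto intro!: borel_measurable_diff meas)
  have X: "has_bochner_integral (\<Pi>\<^sub>M i\<in>I. \<mu> i) (X i) 0" if "i \<in> I" for i
    using has_bochner_integral_diff[OF mean[OF that] const[of "m i"]]
    by (simp add: X_def[abs_def] prob_space)
  have Xsq: "integrable (\<Pi>\<^sub>M i\<in>I. \<mu> i) (\<lambda>x. (X i x)\<^sup>2)"
      "expectation (\<lambda>x. (X i x)\<^sup>2) = (\<integral>y. (f i y - m i)\<^sup>2 \<partial>\<mu> i)" if "i \<in> I" for i
  proof -
    have [measurable]: "(\<lambda>y. (f i y - m i)\<^sup>2) \<in> borel_measurable (\<mu> i)"
      using meas[OF that] by measurable
    show "integrable (\<Pi>\<^sub>M i\<in>I. \<mu> i) (\<lambda>x. (X i x)\<^sup>2)"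
      "expectation (\<lambda>x. (X i x)\<^sup>2) = (\<integral>y. (f i y - m i)\<^sup>2 \<partial>\<mu> i)"
      unfolding X_def using sq[OF that]
        integrable_PiM_component[where f = "\<lambda>y. (f i y - m i)\<^sup>2" and \<mu> = \<mu> and I = I, OF \<mu> that]
        integral_PiM_component[where f = "\<lambda>y. (f i y - m i)\<^sup>2" and \<mu> = \<mu> and I = I, OF \<mu> that] by simp_all
  qed
  have sumsq: "has_bochner_integral (\<Pi>\<^sub>M i\<in>I. \<mu> i) (\<lambda>x. (\<Sum>i\<in>I. X i x)\<^sup>2)
      (\<Sum>i\<in>I. \<integral>y. (f i y - m i)\<^sup>2 \<partial>\<mu> i)"
    using expectation_square_indep_sum[OF I(1) indep] X Xsq
    by (simp add: has_bochner_integral_iff)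
  \<comment> \<open>The square is the centered square plus an affine function of the sum, so its
    expectation follows by linearity from \<open>sumsq\<close> and \<open>sum\<close>.
    \<open>val_eq\<close> puts the claimed value into the same shape.\<close>
  have sq_eq: "(\<Sum>i\<in>I. f i (x i))\<^sup>2 =
      (\<Sum>i\<in>I. X i x)\<^sup>2 + 2 * (\<Sum>i\<in>I. m i) * (\<Sum>i\<in>I. f i (x i)) - (\<Sum>i\<in>I. m i)\<^sup>2" for x
    by (simp add: X_def sum_subtractf power2_eq_square algebra_simps)
  have val_eq: "(\<Sum>i\<in>I. m i)\<^sup>2 + V = V + 2 * (\<Sum>i\<in>I. m i) * (\<Sum>i\<in>I. m i) - (\<Sum>i\<in>I. m i)\<^sup>2" for V
    by (simp add: power2_eq_square)
  show "has_bochner_integral (\<Pi>\<^sub>M i\<in>I. \<mu> i) (\<lambda>x. (\<Sum>i\<in>I. f i (x i))\<^sup>2)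
        ((\<Sum>i\<in>I. m i)\<^sup>2 + (\<Sum>i\<in>I. \<integral>y. (f i y - m i)\<^sup>2 \<partial>\<mu> i))"
    unfolding sq_eq val_eq
    by (intro has_bochner_integral_diff has_bochner_integral_add sumsq has_bochner_integral_mult_right sum const)
qed

subsection \<open>The transition kernel of one round\<close>

lemma space_euclid: "space (euclid d) = points d"
  by (simp add: euclid_def space_PiM)

lemma measurable_euclid_component: "i < d \<Longrightarrow> (\<lambda>x. x i) \<in> borel_measurable (euclid d)"
  by (simp add: euclid_def)

lemma measurable_restrict_euclid:
  "(\<And>i. i < d \<Longrightarrow> (\<lambda>\<omega>. f i \<omega>) \<in> borel_measurable N) \<Longrightarrow> (\<lambda>\<omega>. \<lambda>i\<in>{..<d}. f i \<omega>) \<in> N \<rightarrow>\<^sub>M euclid d"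
  unfolding euclid_def by (rule measurable_restrict) auto

lemma measurable_lincomb:
  assumes f: "f \<in> N \<rightarrow>\<^sub>M euclid d" and g: "g \<in> N \<rightarrow>\<^sub>M euclid d"
  shows "(\<lambda>\<omega>. lincomb d a (f \<omega>) b (g \<omega>)) \<in> N \<rightarrow>\<^sub>M euclid d"
  unfolding lincomb_def
proof (rule measurable_restrict_euclid)
  fix i assume i: "i < d"
  note [measurable] = measurable_compose[OF f measurable_euclid_component[OF i]]
    measurable_compose[OF g measurable_euclid_component[OF i]]
  show "(\<lambda>\<omega>. a * f \<omega> i + b * g \<omega> i) \<in> borel_measurable N" by measurable
qed

lemma measurable_minibatch_avg:
  "minibatch_avg d M K \<in> (\<Pi>\<^sub>M q\<in>{..<M} \<times> {..<K}. euclid d) \<rightarrow>\<^sub>M euclid d"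
  unfolding minibatch_avg_def[abs_def]
proof (rule measurable_restrict_euclid)
  fix i assume i: "i < d"
  have "(\<lambda>g. g q i) \<in> borel_measurable (\<Pi>\<^sub>M q\<in>{..<M} \<times> {..<K}. euclid d)"
    if "q \<in> {..<M} \<times> {..<K}" for q
    by (rule measurable_compose[OF measurable_component_singleton[OF that] measurable_euclid_component[OF i]])
  then show "(\<lambda>g. 1 / real (M * K) * (\<Sum>q\<in>{..<M} \<times> {..<K}. g q i))
      \<in> borel_measurable (\<Pi>\<^sub>M q\<in>{..<M} \<times> {..<K}. euclid d)"
    by (intro borel_measurable_times borel_measurable_const borel_measurable_sum)
qed

lemma measurable_acsa_md: "acsa_md d b \<in> euclid d \<Otimes>\<^sub>M euclid d \<rightarrow>\<^sub>M euclid d"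
  unfolding acsa_md_def split_beta' by (intro measurable_lincomb measurable_fst measurable_snd)

lemma measurable_acsa_update:
  assumes "f \<in> N \<rightarrow>\<^sub>M euclid d \<Otimes>\<^sub>M euclid d" "g \<in> N \<rightarrow>\<^sub>M euclid d"
  shows "(\<lambda>\<omega>. acsa_update d b \<eta> (f \<omega>) (g \<omega>)) \<in> N \<rightarrow>\<^sub>M euclid d \<Otimes>\<^sub>M euclid d"
  unfolding acsa_update_def split_beta' Let_def
  by (intro measurable_Pair measurable_lincomb measurable_compose[OF assms(1) measurable_fst]
      measurable_compose[OF assms(1) measurable_snd] assms(2))

lemma acsa_md_in_points [simp]: "acsa_md d b s \<in> points d"
  by (cases s) (simp only: acsa_md_def case_prod_conv lincomb_in_points)

text \<open>One round of \<open>acsa_law\<close> with the round index already applied to the oracle.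
  Isolating it lets the step be treated as a Markov kernel and the recursion as a bind with that
  kernel.\<close>

definition acsa_kernel ::
  "nat \<Rightarrow> nat \<Rightarrow> nat \<Rightarrow> real \<Rightarrow> real \<Rightarrow> (nat \<Rightarrow> nat \<Rightarrow> rvec \<Rightarrow> rvec measure) \<Rightarrow>
    rvec \<times> rvec \<Rightarrow> (rvec \<times> rvec) measure" where
  "acsa_kernel d M K b \<eta> Q s =
     distr (\<Pi>\<^sub>M q\<in>{..<M} \<times> {..<K}. Q (fst q) (snd q) (acsa_md d b s)) (euclid d \<Otimes>\<^sub>M euclid d)
       (\<lambda>g. acsa_update d b \<eta> s (minibatch_avg d M K g))"

lemma acsa_law_Suc:
  "acsa_law d M K \<beta> \<gamma> Q (Suc t) =
    acsa_law d M K \<beta> \<gamma> Q t \<bind> acsa_kernel d M K (\<beta> t) (\<gamma> t) (\<lambda>m. Q m t)"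
  by (simp add: acsa_kernel_def[abs_def])

lemma measurable_acsa_kernel:
  assumes Q: "\<And>m k. m < M \<Longrightarrow> k < K \<Longrightarrow> Q m k \<in> euclid d \<rightarrow>\<^sub>M prob_algebra (euclid d)"
  shows "acsa_kernel d M K b \<eta> Q \<in> euclid d \<Otimes>\<^sub>M euclid d \<rightarrow>\<^sub>M prob_algebra (euclid d \<Otimes>\<^sub>M euclid d)"
  unfolding acsa_kernel_def[abs_def]
proof (rule measurable_distr_prob_space2)
  show "(\<lambda>s. \<Pi>\<^sub>M q\<in>{..<M} \<times> {..<K}. Q (fst q) (snd q) (acsa_md d b s))
      \<in> euclid d \<Otimes>\<^sub>M euclid d \<rightarrow>\<^sub>M prob_algebra (\<Pi>\<^sub>M q\<in>{..<M} \<times> {..<K}. euclid d)"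
    by (rule measurable_PiM_kernel) (auto intro!: measurable_compose[OF measurable_acsa_md] Q)
  show "(\<lambda>(s, g). acsa_update d b \<eta> s (minibatch_avg d M K g))
      \<in> (euclid d \<Otimes>\<^sub>M euclid d) \<Otimes>\<^sub>M (\<Pi>\<^sub>M q\<in>{..<M} \<times> {..<K}. euclid d) \<rightarrow>\<^sub>M euclid d \<Otimes>\<^sub>M euclid d"
    unfolding split_beta'
    by (intro measurable_acsa_update measurable_fst measurable_compose[OF measurable_snd measurable_minibatch_avg])
qed

lemma measurable_gradient_oracle:
  "gradient_oracle d \<sigma> M K R Fs Q \<Longrightarrow> t < R \<Longrightarrow> m < M \<Longrightarrow> k < K \<Longrightarrow>
    Q m t k \<in> euclid d \<rightarrow>\<^sub>M prob_algebra (euclid d)"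
  by (simp add: gradient_oracle_def)

lemma zero_v_in_points: "zero_v d \<in> points d"
  by (simp add: zero_v_def)

text \<open>Binding with a probability kernel is a map from \<open>prob_algebra\<close> to itself,
  so induction gives both the sigma-algebra and total mass 1 of every law.\<close>

lemma acsa_law_in_space:
  assumes Q: "gradient_oracle d \<sigma> M K R Fs Q"
  shows "t \<le> R \<Longrightarrow> acsa_law d M K \<beta> \<gamma> Q t \<in> space (prob_algebra (euclid d \<Otimes>\<^sub>M euclid d))"
proof (induction t)
  case 0
  then show ?case
    using zero_v_in_points
    by (auto simp: space_prob_algebra space_pair_measure space_euclid intro!: prob_space_return)
next
  case (Suc t)
  let ?E = "euclid d \<Otimes>\<^sub>M euclid d"
  have "(\<lambda>\<mu>. \<mu> \<bind> acsa_kernel d M K (\<beta> t) (\<gamma> t) (\<lambda>m. Q m t)) \<in> prob_algebra ?E \<rightarrow>\<^sub>M prob_algebra ?E"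
    using Suc.prems
    by (intro measurable_bind_prob_space[where N = ?E] measurable_ident measurable_acsa_kernel
        measurable_gradient_oracle[OF Q]) auto
  from measurable_space[OF this] Suc show ?case
    unfolding acsa_law_Suc by auto
qed

section \<open>First and second moments of the minibatch gradient\<close>

lemma
  assumes N: "sets N = sets (euclid d)"
    and sq: "(\<integral>\<^sup>+ g. ennreal ((dist_v d g c)\<^sup>2) \<partial>N) \<le> ennreal (\<sigma>\<^sup>2)"
  shows integrable_component_square: "i < d \<Longrightarrow> integrable N (\<lambda>g. (g i - c i)\<^sup>2)"
    and sum_integral_component_square: "(\<Sum>i<d. \<integral>g. (g i - c i)\<^sup>2 \<partial>N) \<le> \<sigma>\<^sup>2"
proof -
  have meas: "(\<lambda>g. (g i - c i)\<^sup>2) \<in> borel_measurable N" if "i < d" for i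
  proof -
    have [measurable]: "(\<lambda>g. g i) \<in> borel_measurable N"
      using measurable_euclid_component[OF that] measurable_cong_sets[OF N refl] by auto
    show ?thesis by measurable
  qed
  show int: "integrable N (\<lambda>g. (g i - c i)\<^sup>2)" if i: "i < d" for i
  proof (rule integrableI_nonneg[OF meas[OF i]])
    \<comment> \<open>One squared coordinate is dominated by the whole squared distance, whose
      integral is finite.\<close>
    have "(\<integral>\<^sup>+ g. ennreal ((g i - c i)\<^sup>2) \<partial>N) \<le> (\<integral>\<^sup>+ g. ennreal ((dist_v d g c)\<^sup>2) \<partial>N)"
      unfolding dist_v_sq using i
      by (intro nn_integral_mono ennreal_leI member_le_sum[of i "{..<d}" "\<lambda>i. (_ i - c i)\<^sup>2"]) auto
    also note sq
    finally show "(\<integral>\<^sup>+ g. ennreal ((g i - c i)\<^sup>2) \<partial>N) < \<infinity>"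
      by (simp add: le_less_trans)
  qed simp
  have "ennreal (\<integral>g. (dist_v d g c)\<^sup>2 \<partial>N) = (\<integral>\<^sup>+ g. ennreal ((dist_v d g c)\<^sup>2) \<partial>N)"
    unfolding dist_v_sq by (intro nn_integral_eq_integral[symmetric] Bochner_Integration.integrable_sum int)
      (auto intro!: AE_I2 sum_nonneg)
  with sq have "(\<integral>g. (dist_v d g c)\<^sup>2 \<partial>N) \<le> \<sigma>\<^sup>2" by (metis ennreal_le_iff zero_le_power2)
  then show "(\<Sum>i<d. \<integral>g. (g i - c i)\<^sup>2 \<partial>N) \<le> \<sigma>\<^sup>2"
    unfolding dist_v_sq using int by (subst (asm) Bochner_Integration.integral_sum) auto
qed

text \<open>\<open>v i\<close> is the variance of coordinate \<open>i\<close> of the average.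
  Variances of independent answers add and averaging multiplies by \<open>1 / (M * K)^2\<close>, so
  \<open>M * K\<close> answers of total variance at most \<open>\<sigma>^2\<close> leave
  \<open>\<sigma>^2 / (M * K)\<close>.\<close>

lemma minibatch_moments:
  fixes M K :: nat and \<mu> :: "nat \<times> nat \<Rightarrow> rvec measure"
  defines "J \<equiv> {..<M} \<times> {..<K}"
  assumes MK: "M \<ge> 1" "K \<ge> 1"
    and \<mu>: "\<And>q. q \<in> J \<Longrightarrow> prob_space (\<mu> q)" "\<And>q. q \<in> J \<Longrightarrow> sets (\<mu> q) = sets (euclid d)"
    and mean: "\<And>q i. q \<in> J \<Longrightarrow> i < d \<Longrightarrow> has_bochner_integral (\<mu> q) (\<lambda>g. g i) (m q i)"
    and sq: "\<And>q. q \<in> J \<Longrightarrow> (\<integral>\<^sup>+ g. ennreal ((dist_v d g (m q))\<^sup>2) \<partial>\<mu> q) \<le> ennreal (\<sigma>\<^sup>2)"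
    and G: "\<And>i. i < d \<Longrightarrow> G i = (1 / real (M * K)) * (\<Sum>q\<in>J. m q i)"
  obtains v where
    "\<And>i. i < d \<Longrightarrow> has_bochner_integral (\<Pi>\<^sub>M q\<in>J. \<mu> q) (\<lambda>g. minibatch_avg d M K g i) (G i)"
    "\<And>i. i < d \<Longrightarrow> has_bochner_integral (\<Pi>\<^sub>M q\<in>J. \<mu> q) (\<lambda>g. (minibatch_avg d M K g i)\<^sup>2) ((G i)\<^sup>2 + v i)"
    "(\<Sum>i<d. v i) \<le> \<sigma>\<^sup>2 / real (M * K)"
proof
  define n where "n = real (M * K)"
  define V where "V q i = (\<integral>g. (g i - m q i)\<^sup>2 \<partial>\<mu> q)" for q i
  define v where "v i = (1 / n)\<^sup>2 * (\<Sum>q\<in>J. V q i)" for i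
  have J: "finite J" "J \<noteq> {}" using MK by (auto simp: J_def lessThan_empty_iff)
  fix i assume i: "i < d"
  have avg: "minibatch_avg d M K g i = (1 / n) * (\<Sum>q\<in>J. g q i)" for g
    using i by (simp add: minibatch_avg_def n_def J_def)
  note sums = has_bochner_integral_PiM_sum[where \<mu> = \<mu> and f = "\<lambda>q g. g i" and m = "\<lambda>q. m q i", OF \<mu>(1) J mean]
    has_bochner_integral_PiM_sum_square[where \<mu> = \<mu> and f = "\<lambda>q g. g i" and m = "\<lambda>q. m q i", OF \<mu>(1) J mean]
  have int: "integrable (\<mu> q) (\<lambda>g. (g i - m q i)\<^sup>2)" if "q \<in> J" for q
    by (rule integrable_component_square[OF \<mu>(2)[OF that] sq[OF that] i])
  show "has_bochner_integral (\<Pi>\<^sub>M q\<in>J. \<mu> q) (\<lambda>g. minibatch_avg d M K g i) (G i)"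
    unfolding avg G[OF i] n_def[symmetric] using i int
    by (intro has_bochner_integral_mult_right sums) auto
  have Gsq: "(G i)\<^sup>2 + v i = (1 / n)\<^sup>2 * ((\<Sum>q\<in>J. m q i)\<^sup>2 + (\<Sum>q\<in>J. V q i))"
    unfolding v_def G[OF i] n_def by (simp add: power_mult_distrib distrib_left power_divide)
  show "has_bochner_integral (\<Pi>\<^sub>M q\<in>J. \<mu> q) (\<lambda>g. (minibatch_avg d M K g i)\<^sup>2) ((G i)\<^sup>2 + v i)"
    unfolding avg Gsq power_mult_distrib V_def using i int
    by (intro has_bochner_integral_mult_right sums) auto
next
  define n where "n = real (M * K)"
  have n: "n > 0" and cardJ: "real (card J) = n"
    using MK by (auto simp: n_def J_def card_cartesian_product)
  \<comment> \<open>The second-moment goal has already instantiated \<open>v\<close>, so the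
    variances appear written out here.\<close>
  have "(\<Sum>i<d. (1 / n)\<^sup>2 * (\<Sum>q\<in>J. \<integral>g. (g i - m q i)\<^sup>2 \<partial>\<mu> q)) =
      (1 / n)\<^sup>2 * (\<Sum>q\<in>J. \<Sum>i<d. \<integral>g. (g i - m q i)\<^sup>2 \<partial>\<mu> q)"
    by (subst sum.swap) (simp add: sum_distrib_left)
  also have "\<dots> \<le> (1 / n)\<^sup>2 * (\<Sum>q\<in>J. \<sigma>\<^sup>2)"
    by (intro mult_left_mono sum_mono sum_integral_component_square \<mu>(2) sq) auto
  also have "\<dots> = \<sigma>\<^sup>2 / n"
    using n cardJ by (simp add: power2_eq_square field_simps)
  finally show "(\<Sum>i<d. (1 / real (M * K))\<^sup>2 * (\<Sum>q\<in>J. \<integral>g. (g i - m q i)\<^sup>2 \<partial>\<mu> q)) \<le> \<sigma>\<^sup>2 / real (M * K)"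
    by (simp add: n_def)
qed

subsection \<open>The potential argument\<close>

locale convex_smooth =
  fixes d :: nat and H :: real and F :: "rvec \<Rightarrow> real" and xs :: rvec
  assumes cvx: "convex_v d F" and smooth: "smooth_v d H F" and H_nonneg: "H \<ge> 0"
    and minimizer: "is_arg_min F (\<lambda>x. x \<in> points d) xs"
begin

lemma xs_in_points: "xs \<in> points d"
  using minimizer by (simp add: is_arg_min_def)

lemma F_min: "x \<in> points d \<Longrightarrow> F xs \<le> F x"
  using minimizer by (simp add: is_arg_min_linorder)

lemma has_gradient_F: "x \<in> points d \<Longrightarrow> has_gradient d F (gradient d F x) x"
  using smooth differentiable_has_gradient by (auto simp: smooth_v_def)

lemma measurable_F: "F \<in> borel_measurable (euclid d)"
  by (rule convex_smooth_borel_measurable[OF cvx smooth])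

text \<open>With weight \<open>\<gamma>\<^sub>t (\<beta>\<^sub>t - 1)\<close> this is the Lyapunov function of AC-SA before round \<open>t\<close>;
  after the round the suboptimality carries weight \<open>\<gamma>\<^sub>t \<beta>\<^sub>t\<close>.\<close>

definition potential :: "real \<Rightarrow> rvec \<times> rvec \<Rightarrow> real" where
  "potential w s = w * (F (snd s) - F xs) + (\<Sum>i<d. (fst s i - xs i)\<^sup>2) / 2"

lemma potential_nonneg: "w \<ge> 0 \<Longrightarrow> snd s \<in> points d \<Longrightarrow> potential w s \<ge> 0"
  unfolding potential_def using F_min by (intro add_nonneg_nonneg mult_nonneg_nonneg) (auto intro: sum_nonneg)

lemma measurable_potential: "potential w \<in> borel_measurable (euclid d \<Otimes>\<^sub>M euclid d)"
proof -
  have [measurable]: "(\<lambda>s. F (snd s)) \<in> borel_measurable (euclid d \<Otimes>\<^sub>M euclid d)"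
    by (rule measurable_compose[OF measurable_snd measurable_F])
  have "(\<lambda>s. fst s i) \<in> borel_measurable (euclid d \<Otimes>\<^sub>M euclid d)" if "i < d" for i
    by (rule measurable_compose[OF measurable_fst measurable_euclid_component[OF that]])
  then have [measurable]: "(\<lambda>s. \<Sum>i<d. (fst s i - xs i)\<^sup>2) \<in> borel_measurable (euclid d \<Otimes>\<^sub>M euclid d)"
    by (intro borel_measurable_sum borel_measurable_power borel_measurable_diff borel_measurable_const) auto
  show ?thesis unfolding potential_def[abs_def] by measurable
qed

text \<open>A pathwise bound, for an arbitrary vector \<open>g\<close>. Both \<open>ag'\<close> and
  \<open>y\<close> mix in the same old aggregate, so they differ by
  \<open>- (\<eta> / b) * g\<close>, and the descent lemma applies. With
  \<open>H * \<eta> \<le> b\<close> its curvature term is at most half of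
  \<open>\<eta>^2 * S\<close>; the squared distance to \<open>xs\<close> contributes the other half.
  The bound is quadratic in \<open>g\<close>, so two moments will determine its expectation.\<close>

lemma potential_acsa_update_le:
  assumes b: "b \<ge> 1" and \<eta>: "\<eta> \<ge> 0" and H\<eta>: "H * \<eta> \<le> b"
    and s: "s \<in> points d \<times> points d"
  defines "y \<equiv> acsa_md d b s"
  shows "potential (\<eta> * b) (acsa_update d b \<eta> s g) \<le>
    \<eta> * b * (F y - F xs) + (\<Sum>i<d. (fst s i - xs i)\<^sup>2) / 2
      - (\<Sum>i<d. (\<eta>\<^sup>2 * gradient d F y i + \<eta> * (fst s i - xs i)) * g i) + \<eta>\<^sup>2 * (\<Sum>i<d. (g i)\<^sup>2)"
proof -
  define x' where "x' = fst (acsa_update d b \<eta> s g)"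
  define ag' where "ag' = snd (acsa_update d b \<eta> s g)"
  define S where "S = (\<Sum>i<d. (g i)\<^sup>2)"
  have S: "S \<ge> 0" by (simp add: S_def sum_nonneg)
  have x': "x' i = fst s i - \<eta> * g i" if "i < d" for i
    using that by (simp add: x'_def acsa_update_def split_beta Let_def)
  have diff: "ag' i - y i = - (\<eta> / b) * g i" if "i < d" for i
    using that b by (simp add: ag'_def y_def acsa_update_def acsa_md_def split_beta Let_def field_simps)
  have ag': "ag' \<in> points d"
    by (simp only: ag'_def acsa_update_def split_beta Let_def snd_conv lincomb_in_points)
  have y: "y \<in> points d" by (simp only: y_def acsa_md_in_points)
  have "F ag' \<le> F y + (\<Sum>i<d. gradient d F y i * (ag' i - y i)) + H / 2 * (dist_v d ag' y)\<^sup>2"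
    by (rule smooth_quadratic_upper[OF smooth y ag'])
  also have "(\<Sum>i<d. gradient d F y i * (ag' i - y i)) = - (\<eta> / b) * (\<Sum>i<d. gradient d F y i * g i)"
    unfolding sum_distrib_left by (rule sum.cong) (simp_all add: diff)
  also have "(dist_v d ag' y)\<^sup>2 = (\<eta> / b)\<^sup>2 * S"
    unfolding dist_v_sq S_def sum_distrib_left by (rule sum.cong) (simp_all add: diff power_mult_distrib power_divide)
  finally have "\<eta> * b * F ag' \<le> \<eta> * b * (F y + - (\<eta> / b) * (\<Sum>i<d. gradient d F y i * g i) + H / 2 * ((\<eta> / b)\<^sup>2 * S))"
    using \<eta> b by (intro mult_left_mono) auto
  also have "\<dots> = \<eta> * b * F y - \<eta>\<^sup>2 * (\<Sum>i<d. gradient d F y i * g i) + (H * \<eta> / b) * (\<eta>\<^sup>2 / 2 * S)"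
    using b by (simp add: field_simps power2_eq_square)
  also have "(H * \<eta> / b) * (\<eta>\<^sup>2 / 2 * S) \<le> 1 * (\<eta>\<^sup>2 / 2 * S)"
    using S H\<eta> b by (intro mult_right_mono) auto
  finally have 1: "\<eta> * b * F ag' \<le> \<eta> * b * F y - \<eta>\<^sup>2 * (\<Sum>i<d. gradient d F y i * g i) + \<eta>\<^sup>2 / 2 * S"
    by simp
  have "(\<Sum>i<d. (x' i - xs i)\<^sup>2) = (\<Sum>i<d. (fst s i - xs i)\<^sup>2 - 2 * \<eta> * ((fst s i - xs i) * g i) + \<eta>\<^sup>2 * (g i)\<^sup>2)"
    by (rule sum.cong) (simp_all add: x' power2_eq_square algebra_simps)
  then have 2: "(\<Sum>i<d. (x' i - xs i)\<^sup>2) =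
      (\<Sum>i<d. (fst s i - xs i)\<^sup>2) - 2 * \<eta> * (\<Sum>i<d. (fst s i - xs i) * g i) + \<eta>\<^sup>2 * S"
    by (simp add: S_def sum.distrib sum_subtractf sum_distrib_left)
  have 3: "(\<Sum>i<d. (\<eta>\<^sup>2 * gradient d F y i + \<eta> * (fst s i - xs i)) * g i) =
      \<eta>\<^sup>2 * (\<Sum>i<d. gradient d F y i * g i) + \<eta> * (\<Sum>i<d. (fst s i - xs i) * g i)"
    by (simp add: sum_distrib_left sum.distrib distrib_right mult.assoc)
  show ?thesis
    using 1 unfolding potential_def x'_def[symmetric] ag'_def[symmetric] 2 3 S_def[symmetric]
    by (simp add: right_diff_distrib distrib_left add_divide_distrib diff_divide_distrib)
qed

text \<open>The tangent inequality at \<open>y\<close> is used towards \<open>xs\<close> with weight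
  1 and towards the aggregate with weight \<open>b - 1\<close>. Since \<open>b * y\<close> equals
  the iterate plus \<open>b - 1\<close> times the aggregate, the linear terms collapse to the inner
  product with \<open>fst s - xs\<close>.\<close>

lemma acsa_md_convexity:
  assumes b: "b \<ge> 1" and s: "s \<in> points d \<times> points d"
  defines "y \<equiv> acsa_md d b s"
  shows "b * (F y - F xs) - (\<Sum>i<d. gradient d F y i * (fst s i - xs i)) \<le> (b - 1) * (F (snd s) - F xs)"
proof -
  let ?G = "gradient d F y"
  have y: "y \<in> points d" by (simp only: y_def acsa_md_in_points)
  note below = convex_gradient_below[OF cvx has_gradient_F[OF y] y]
  have "F y + (\<Sum>i<d. ?G i * (xs i - y i)) + (b - 1) * (F y + (\<Sum>i<d. ?G i * (snd s i - y i)))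
      \<le> F xs + (b - 1) * F (snd s)"
    using b below[OF xs_in_points] mult_left_mono[OF below[of "snd s"], of "b - 1"] s
    by (simp add: mem_Times_iff)
  moreover have "(\<Sum>i<d. ?G i * (xs i - y i)) + (b - 1) * (\<Sum>i<d. ?G i * (snd s i - y i)) =
      - (\<Sum>i<d. ?G i * (fst s i - xs i))"
    unfolding sum_distrib_left sum_negf[symmetric] sum.distrib[symmetric]
  proof (rule sum.cong[OF refl])
    fix i assume "i \<in> {..<d}"
    then have "b * y i = fst s i + (b - 1) * snd s i"
      using b by (simp add: y_def acsa_md_def split_beta field_simps)
    then have "(xs i - y i) + (b - 1) * (snd s i - y i) = - (fst s i - xs i)"
      by (simp add: algebra_simps)
    from arg_cong[OF this, of "\<lambda>r. ?G i * r"]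
    show "?G i * (xs i - y i) + (b - 1) * (?G i * (snd s i - y i)) = - (?G i * (fst s i - xs i))"
      by (simp add: algebra_simps)
  qed
  ultimately show ?thesis by (simp add: algebra_simps)
qed

text \<open>One round in expectation, for any random vector whose mean is the gradient at the query
  point: integrate the pathwise quadratic bound, then apply convexity.\<close>

lemma nn_integral_potential_step:
  assumes b: "b \<ge> 1" and \<eta>: "\<eta> \<ge> 0" and H\<eta>: "H * \<eta> \<le> b"
    and s: "s \<in> points d \<times> points d" and P: "prob_space P"
  defines "G \<equiv> gradient d F (acsa_md d b s)"
  assumes mean: "\<And>i. i < d \<Longrightarrow> has_bochner_integral P (\<lambda>\<omega>. g \<omega> i) (G i)"
    and sq: "\<And>i. i < d \<Longrightarrow> has_bochner_integral P (\<lambda>\<omega>. (g \<omega> i)\<^sup>2) ((G i)\<^sup>2 + v i)"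
    and v: "(\<Sum>i<d. v i) \<le> V"
  shows "(\<integral>\<^sup>+ \<omega>. ennreal (potential (\<eta> * b) (acsa_update d b \<eta> s (g \<omega>))) \<partial>P)
    \<le> ennreal (potential (\<eta> * (b - 1)) s + \<eta>\<^sup>2 * V)"
proof -
  interpret prob_space P by fact
  define y where "y = acsa_md d b s"
  define A where "A = \<eta> * b * (F y - F xs) + (\<Sum>i<d. (fst s i - xs i)\<^sup>2) / 2"
  define a where "a i = \<eta>\<^sup>2 * G i + \<eta> * (fst s i - xs i)" for i
  define q where "q \<omega> = A - (\<Sum>i<d. a i * g \<omega> i) + \<eta>\<^sup>2 * (\<Sum>i<d. (g \<omega> i)\<^sup>2)" for \<omega>
  have le_q: "potential (\<eta> * b) (acsa_update d b \<eta> s (g \<omega>)) \<le> q \<omega>" for \<omega>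
    using potential_acsa_update_le[OF b \<eta> H\<eta> s, of "g \<omega>"]
    by (simp add: q_def A_def a_def G_def y_def)
  have nonneg: "potential (\<eta> * b) (acsa_update d b \<eta> s (g \<omega>)) \<ge> 0" for \<omega>
    using b \<eta> by (intro potential_nonneg)
      (simp_all only: acsa_update_def split_beta Let_def snd_conv lincomb_in_points mult_nonneg_nonneg)
  have const: "has_bochner_integral P (\<lambda>_. c) c" for c :: real
    by (simp add: has_bochner_integral_iff prob_space)
  have q_int: "has_bochner_integral P q
      (A - (\<Sum>i<d. a i * G i) + \<eta>\<^sup>2 * (\<Sum>i<d. (G i)\<^sup>2 + v i))"
    unfolding q_def
    by (intro has_bochner_integral_add has_bochner_integral_diff const has_bochner_integral_sum
        has_bochner_integral_mult_right mean sq) auto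
  have "(\<integral>\<^sup>+ \<omega>. ennreal (potential (\<eta> * b) (acsa_update d b \<eta> s (g \<omega>))) \<partial>P) \<le> (\<integral>\<^sup>+ \<omega>. ennreal (q \<omega>) \<partial>P)"
    by (intro nn_integral_mono ennreal_leI le_q)
  \<comment> \<open>\<open>q\<close> is nonnegative because it dominates the nonnegative potential,
    so its two integrals agree.\<close>
  also have "\<dots> = ennreal (integral\<^sup>L P q)"
    using q_int order_trans[OF nonneg le_q]
    by (intro nn_integral_eq_integral) (auto simp: has_bochner_integral_iff)
  also have "integral\<^sup>L P q = A - (\<Sum>i<d. a i * G i) + \<eta>\<^sup>2 * (\<Sum>i<d. (G i)\<^sup>2 + v i)"
    using q_int by (rule has_bochner_integral_integral_eq)
  \<comment> \<open>The squared gradient norm from the second moment cancels the one in the linear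
    term; only the variance survives.\<close>
  also have "\<dots> = A - \<eta> * (\<Sum>i<d. G i * (fst s i - xs i)) + \<eta>\<^sup>2 * (\<Sum>i<d. v i)"
  proof -
    have "(\<Sum>i<d. a i * G i) = \<eta>\<^sup>2 * (\<Sum>i<d. (G i)\<^sup>2) + \<eta> * (\<Sum>i<d. G i * (fst s i - xs i))"
      unfolding sum_distrib_left sum.distrib[symmetric]
      by (rule sum.cong) (simp_all add: a_def power2_eq_square algebra_simps)
    then show ?thesis by (simp add: sum.distrib distrib_left)
  qed
  also have "ennreal \<dots> \<le> ennreal (potential (\<eta> * (b - 1)) s + \<eta>\<^sup>2 * V)"
  proof (rule ennreal_leI)
    have "\<eta> * (b * (F y - F xs) - (\<Sum>i<d. G i * (fst s i - xs i))) \<le> \<eta> * ((b - 1) * (F (snd s) - F xs))"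
      using acsa_md_convexity[OF b s] \<eta> by (intro mult_left_mono) (simp_all add: G_def y_def)
    moreover have "\<eta>\<^sup>2 * (\<Sum>i<d. v i) \<le> \<eta>\<^sup>2 * V" by (intro mult_left_mono v) simp
    ultimately show "A - \<eta> * (\<Sum>i<d. G i * (fst s i - xs i)) + \<eta>\<^sup>2 * (\<Sum>i<d. v i)
        \<le> potential (\<eta> * (b - 1)) s + \<eta>\<^sup>2 * V"
      by (simp add: A_def potential_def algebra_simps)
  qed
  finally show ?thesis .
qed

lemma F_zero_le: "F (zero_v d) - F xs \<le> H / 2 * (L2_set xs {..<d})\<^sup>2"
proof -
  let ?v = "\<lambda>i. zero_v d i - xs i"
  \<comment> \<open>Along the line through the origin, \<open>xs\<close> is a minimum, so the
    derivative there vanishes and the descent lemma from \<open>xs\<close> has no linear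
    term.\<close>
  have "(\<Sum>i<d. gradient d F xs i * ?v i) = 0"
  proof (rule DERIV_local_min[OF has_gradient_directional[OF has_gradient_F xs_in_points], where d = 1])
    show "\<forall>u. \<bar>0 - u\<bar> < 1 \<longrightarrow> F (lincomb d 1 xs 0 ?v) \<le> F (lincomb d 1 xs u ?v)"
      using F_min[OF lincomb_in_points] lincomb_move_zero[OF xs_in_points, of ?v] by metis
  qed (simp_all add: xs_in_points)
  moreover have "dist_v d (zero_v d) xs = L2_set xs {..<d}"
    by (simp add: dist_v_def L2_set_def zero_v_def)
  ultimately show ?thesis
    using smooth_quadratic_upper[OF smooth xs_in_points zero_v_in_points] by simp
qed

lemma nn_integral_potential_kernel:
  assumes b: "b \<ge> 1" and \<eta>: "\<eta> \<ge> 0" and H\<eta>: "H * \<eta> \<le> b" and s: "s \<in> points d \<times> points d"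
    and MK: "M \<ge> 1" "K \<ge> 1" and Q: "gradient_oracle d \<sigma> M K R Fs Q" and t: "t < R"
    and diff: "\<And>m. m < M \<Longrightarrow> differentiable_v d (Fs m)" and F: "F = avg_obj M Fs"
  shows "(\<integral>\<^sup>+ s'. ennreal (potential (\<eta> * b) s') \<partial>acsa_kernel d M K b \<eta> (\<lambda>m. Q m t) s)
    \<le> ennreal (potential (\<eta> * (b - 1)) s + \<eta>\<^sup>2 * (\<sigma>\<^sup>2 / real (M * K)))"
proof -
  let ?E = "euclid d \<Otimes>\<^sub>M euclid d"
  define J where "J = {..<M} \<times> {..<K}"
  define y where "y = acsa_md d b s"
  define \<mu> where "\<mu> q = Q (fst q) t (snd q) y" for q
  have y: "y \<in> points d" by (simp only: y_def acsa_md_in_points)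
  have Q': "Q (fst q) t (snd q) \<in> euclid d \<rightarrow>\<^sub>M prob_algebra (euclid d)"
      "\<And>i. i < d \<Longrightarrow> has_bochner_integral (\<mu> q) (\<lambda>g. g i) (gradient d (Fs (fst q)) y i)"
      "(\<integral>\<^sup>+ g. ennreal ((dist_v d g (gradient d (Fs (fst q)) y))\<^sup>2) \<partial>\<mu> q) \<le> ennreal (\<sigma>\<^sup>2)"
    if "q \<in> J" for q
  proof -
    have "fst q < M" "snd q < K" using that by (auto simp: J_def)
    with Q t y show "Q (fst q) t (snd q) \<in> euclid d \<rightarrow>\<^sub>M prob_algebra (euclid d)"
      "\<And>i. i < d \<Longrightarrow> has_bochner_integral (\<mu> q) (\<lambda>g. g i) (gradient d (Fs (fst q)) y i)"
      "(\<integral>\<^sup>+ g. ennreal ((dist_v d g (gradient d (Fs (fst q)) y))\<^sup>2) \<partial>\<mu> q) \<le> ennreal (\<sigma>\<^sup>2)"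
      unfolding gradient_oracle_def \<mu>_def by blast+
  qed
  have \<mu>: "prob_space (\<mu> q)" "sets (\<mu> q) = sets (euclid d)" if "q \<in> J" for q
    using measurable_space[OF Q'(1)[OF that], of y] y
    by (simp_all add: \<mu>_def space_prob_algebra space_euclid)
  have grad: "gradient d F y i = (1 / real (M * K)) * (\<Sum>q\<in>J. gradient d (Fs (fst q)) y i)"
    if "i < d" for i
    unfolding F J_def by (rule gradient_avg_obj[OF diff MK(2) y that])
  obtain v where
    v: "\<And>i. i < d \<Longrightarrow> has_bochner_integral (\<Pi>\<^sub>M q\<in>J. \<mu> q) (\<lambda>g. minibatch_avg d M K g i) (gradient d F y i)"
    "\<And>i. i < d \<Longrightarrow> has_bochner_integral (\<Pi>\<^sub>M q\<in>J. \<mu> q) (\<lambda>g. (minibatch_avg d M K g i)\<^sup>2)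
      ((gradient d F y i)\<^sup>2 + v i)"
    "(\<Sum>i<d. v i) \<le> \<sigma>\<^sup>2 / real (M * K)"
    by (rule minibatch_moments[OF MK, folded J_def, OF \<mu> Q'(2,3) grad]) (assumption | rule that)+
  have sets_P: "sets (\<Pi>\<^sub>M q\<in>J. \<mu> q) = sets (\<Pi>\<^sub>M q\<in>J. euclid d)"
    by (intro sets_PiM_cong refl \<mu>(2))
  have avg: "minibatch_avg d M K \<in> (\<Pi>\<^sub>M q\<in>J. \<mu> q) \<rightarrow>\<^sub>M euclid d"
    by (subst measurable_cong_sets[OF sets_P refl]) (simp only: J_def measurable_minibatch_avg)
  have "(\<lambda>g. acsa_update d b \<eta> s (minibatch_avg d M K g)) \<in> (\<Pi>\<^sub>M q\<in>J. \<mu> q) \<rightarrow>\<^sub>M ?E"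
    using s by (intro measurable_acsa_update avg measurable_const)
      (simp add: space_pair_measure space_euclid)
  then have "(\<integral>\<^sup>+ s'. ennreal (potential (\<eta> * b) s') \<partial>acsa_kernel d M K b \<eta> (\<lambda>m. Q m t) s) =
      (\<integral>\<^sup>+ g. ennreal (potential (\<eta> * b) (acsa_update d b \<eta> s (minibatch_avg d M K g))) \<partial>(\<Pi>\<^sub>M q\<in>J. \<mu> q))"
    unfolding acsa_kernel_def J_def \<mu>_def y_def
    using measurable_compose[OF measurable_potential measurable_ennreal]
    by (intro nn_integral_distr) simp_all
  also have "\<dots> \<le> ennreal (potential (\<eta> * (b - 1)) s + \<eta>\<^sup>2 * (\<sigma>\<^sup>2 / real (M * K)))"
    using \<mu>(1) v unfolding y_def
    by (intro nn_integral_potential_step[OF b \<eta> H\<eta> s] prob_space_PiM) auto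
  finally show ?thesis .
qed

lemma potential_mono: "w \<le> w' \<Longrightarrow> snd s \<in> points d \<Longrightarrow> potential w s \<le> potential w' s"
  unfolding potential_def using F_min by (intro add_mono mult_right_mono) auto

text \<open>\<open>w t\<close> is the weight of the suboptimality before round \<open>t\<close>.
  Round \<open>t\<close> needs only weight \<open>\<gamma> t * (\<beta> t - 1)\<close> and returns
  \<open>\<gamma> t * \<beta> t\<close>, so the condition \<open>w(3)\<close> links consecutive
  rounds, each adding \<open>(\<gamma> t)^2\<close> times the variance. \<open>w 0 = 0\<close>
  leaves only the initial squared distance.\<close>

lemma nn_integral_potential_law:
  assumes MK: "M \<ge> 1" "K \<ge> 1" and Q: "gradient_oracle d \<sigma> M K R Fs Q"
    and diff: "\<And>m. m < M \<Longrightarrow> differentiable_v d (Fs m)" and F: "F = avg_obj M Fs"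
    and par: "\<And>t. t < R \<Longrightarrow> \<beta> t \<ge> 1" "\<And>t. t < R \<Longrightarrow> \<gamma> t \<ge> 0" "\<And>t. t < R \<Longrightarrow> H * \<gamma> t \<le> \<beta> t"
    and w: "w 0 = 0" "\<And>t. t < R \<Longrightarrow> w (Suc t) = \<gamma> t * \<beta> t" "\<And>t. t < R \<Longrightarrow> \<gamma> t * (\<beta> t - 1) \<le> w t"
  shows "t \<le> R \<Longrightarrow> (\<integral>\<^sup>+ s. ennreal (potential (w t) s) \<partial>acsa_law d M K \<beta> \<gamma> Q t)
    \<le> ennreal ((L2_set xs {..<d})\<^sup>2 / 2 + \<sigma>\<^sup>2 / real (M * K) * (\<Sum>j<t. (\<gamma> j)\<^sup>2))"
proof (induction t)
  case 0
  have "(\<integral>\<^sup>+ s. ennreal (potential (w 0) s) \<partial>acsa_law d M K \<beta> \<gamma> Q 0) =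
      ennreal (potential (w 0) (zero_v d, zero_v d))"
    unfolding acsa_law.simps(1) using zero_v_in_points
    by (intro nn_integral_return measurable_compose[OF measurable_potential measurable_ennreal])
      (simp add: space_pair_measure space_euclid)
  also have "potential (w 0) (zero_v d, zero_v d) = (L2_set xs {..<d})\<^sup>2 / 2"
    using w(1) by (simp add: potential_def zero_v_def L2_set_def sum_nonneg)
  finally show ?case by simp
next
  case (Suc t)
  let ?E = "euclid d \<Otimes>\<^sub>M euclid d"
  define L where "L = acsa_law d M K \<beta> \<gamma> Q t"
  define V where "V = \<sigma>\<^sup>2 / real (M * K)"
  define C where "C = (L2_set xs {..<d})\<^sup>2 / 2 + V * (\<Sum>j<t. (\<gamma> j)\<^sup>2)"
  have t: "t < R" "t \<le> R" using Suc.prems by auto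
  have V: "V \<ge> 0" by (simp add: V_def)
  have C: "C \<ge> 0" using V by (auto simp: C_def intro!: add_nonneg_nonneg mult_nonneg_nonneg sum_nonneg)
  have L: "sets L = sets ?E" "prob_space L"
    using acsa_law_in_space[OF Q t(2), of \<beta> \<gamma>] by (auto simp: L_def space_prob_algebra)
  have w_nonneg: "w t \<ge> 0"
    using w(3)[OF t(1)] par(1,2)[OF t(1)] by (meson diff_ge_0_iff_ge mult_nonneg_nonneg order_trans)
  have space_L: "s \<in> points d \<times> points d" if "s \<in> space L" for s
    using that sets_eq_imp_space_eq[OF L(1)] by (simp add: space_pair_measure space_euclid)
  have ker: "acsa_kernel d M K (\<beta> t) (\<gamma> t) (\<lambda>m. Q m t) \<in> L \<rightarrow>\<^sub>M subprob_algebra ?E"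
    unfolding measurable_cong_sets[OF L(1) refl]
    by (intro measurable_prob_algebraD measurable_acsa_kernel measurable_gradient_oracle[OF Q t(1)])
  have "(\<integral>\<^sup>+ s. ennreal (potential (w (Suc t)) s) \<partial>acsa_law d M K \<beta> \<gamma> Q (Suc t)) =
      (\<integral>\<^sup>+ s. \<integral>\<^sup>+ s'. ennreal (potential (w (Suc t)) s') \<partial>acsa_kernel d M K (\<beta> t) (\<gamma> t) (\<lambda>m. Q m t) s \<partial>L)"
    unfolding acsa_law_Suc L_def[symmetric]
    by (rule nn_integral_bind[OF measurable_compose[OF measurable_potential measurable_ennreal] ker])
  also have "\<dots> \<le> (\<integral>\<^sup>+ s. ennreal (potential (w t) s) + ennreal ((\<gamma> t)\<^sup>2 * V) \<partial>L)"
  proof (rule nn_integral_mono)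
    fix s assume "s \<in> space L"
    note s = space_L[OF this]
    have "(\<integral>\<^sup>+ s'. ennreal (potential (w (Suc t)) s') \<partial>acsa_kernel d M K (\<beta> t) (\<gamma> t) (\<lambda>m. Q m t) s)
        \<le> ennreal (potential (\<gamma> t * (\<beta> t - 1)) s + (\<gamma> t)\<^sup>2 * V)"
      unfolding w(2)[OF t(1)] V_def
      by (rule nn_integral_potential_kernel[OF par(1-3)[OF t(1)] s MK Q t(1) diff F])
    also have "\<dots> \<le> ennreal (potential (w t) s + (\<gamma> t)\<^sup>2 * V)"
      using potential_mono[OF w(3)[OF t(1)], of s] s by (intro ennreal_leI) (simp add: mem_Times_iff)
    also have "\<dots> = ennreal (potential (w t) s) + ennreal ((\<gamma> t)\<^sup>2 * V)"
      using s V w_nonneg by (intro ennreal_plus potential_nonneg) (simp_all add: mem_Times_iff)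
    finally show "(\<integral>\<^sup>+ s'. ennreal (potential (w (Suc t)) s') \<partial>acsa_kernel d M K (\<beta> t) (\<gamma> t) (\<lambda>m. Q m t) s)
        \<le> ennreal (potential (w t) s) + ennreal ((\<gamma> t)\<^sup>2 * V)" .
  qed
  also have "\<dots> = (\<integral>\<^sup>+ s. ennreal (potential (w t) s) \<partial>L) + ennreal ((\<gamma> t)\<^sup>2 * V)"
    using measurable_compose[OF measurable_potential measurable_ennreal, of "w t"]
    by (subst nn_integral_add)
      (simp_all add: measurable_cong_sets[OF L(1) refl] prob_space.emeasure_space_1[OF L(2)])
  also have "\<dots> \<le> ennreal C + ennreal ((\<gamma> t)\<^sup>2 * V)"
    using Suc.IH[OF t(2)] by (simp add: L_def C_def V_def add_right_mono)
  also have "\<dots> = ennreal (C + (\<gamma> t)\<^sup>2 * V)"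
    using C V by (intro ennreal_plus[symmetric]) auto
  also have "C + (\<gamma> t)\<^sup>2 * V = (L2_set xs {..<d})\<^sup>2 / 2 + V * (\<Sum>j<Suc t. (\<gamma> j)\<^sup>2)"
    by (simp add: C_def algebra_simps)
  finally show ?case unfolding V_def .
qed

text \<open>Discarding the squared distance from the final potential bounds the nonnegative integral
  of \<open>h\<close>. Finiteness makes \<open>h\<close> integrable, and \<open>w R > 0\<close>
  allows \<open>F\<close> to be recovered from \<open>h\<close>; only here does the argument return
  to Bochner integrals.\<close>

lemma acsa_output_suboptimality:
  assumes MK: "M \<ge> 1" "K \<ge> 1" and Q: "gradient_oracle d \<sigma> M K R Fs Q"
    and diff: "\<And>m. m < M \<Longrightarrow> differentiable_v d (Fs m)" and F: "F = avg_obj M Fs"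
    and par: "\<And>t. t < R \<Longrightarrow> \<beta> t \<ge> 1" "\<And>t. t < R \<Longrightarrow> \<gamma> t \<ge> 0" "\<And>t. t < R \<Longrightarrow> H * \<gamma> t \<le> \<beta> t"
    and w: "w 0 = 0" "\<And>t. t < R \<Longrightarrow> w (Suc t) = \<gamma> t * \<beta> t" "\<And>t. t < R \<Longrightarrow> \<gamma> t * (\<beta> t - 1) \<le> w t"
    and w_pos: "w R > 0"
  shows "integrable (acsa_output d M K R \<beta> \<gamma> Q) F"
    and "w R * ((\<integral>x. F x \<partial>acsa_output d M K R \<beta> \<gamma> Q) - F xs)
      \<le> (L2_set xs {..<d})\<^sup>2 / 2 + \<sigma>\<^sup>2 / real (M * K) * (\<Sum>t<R. (\<gamma> t)\<^sup>2)"
proof -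
  define L where "L = acsa_law d M K \<beta> \<gamma> Q R"
  define N where "N = acsa_output d M K R \<beta> \<gamma> Q"
  define C where "C = (L2_set xs {..<d})\<^sup>2 / 2 + \<sigma>\<^sup>2 / real (M * K) * (\<Sum>j<R. (\<gamma> j)\<^sup>2)"
  define h where "h x = w R * (F x - F xs)" for x
  have C: "C \<ge> 0"
    unfolding C_def by (intro add_nonneg_nonneg mult_nonneg_nonneg sum_nonneg) auto
  have L: "sets L = sets (euclid d \<Otimes>\<^sub>M euclid d)" "prob_space L"
    using acsa_law_in_space[OF Q order_refl, of \<beta> \<gamma>] by (auto simp: L_def space_prob_algebra)
  have N: "N = distr L (euclid d) snd" by (simp add: N_def acsa_output_def L_def)
  have snd: "snd \<in> L \<rightarrow>\<^sub>M euclid d"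
    unfolding measurable_cong_sets[OF L(1) refl] by (rule measurable_snd)
  interpret N: prob_space N unfolding N by (rule prob_space.prob_space_distr[OF L(2) snd])
  have spN: "x \<in> points d" if "x \<in> space N" for x using that by (simp add: N space_euclid)
  have hE: "h \<in> borel_measurable (euclid d)"
    unfolding h_def using measurable_F by (intro borel_measurable_times borel_measurable_diff) auto
  then have hN: "h \<in> borel_measurable N" by (simp add: N)
  have h_nonneg: "AE x in N. 0 \<le> h x"
    using F_min spN w_pos by (intro AE_I2) (auto simp: h_def)
  have "(\<integral>\<^sup>+ x. ennreal (h x) \<partial>N) = (\<integral>\<^sup>+ s. ennreal (h (snd s)) \<partial>L)"
    unfolding N using measurable_compose[OF hE measurable_ennreal]
    by (intro nn_integral_distr[OF snd]) simp
  also have "\<dots> \<le> (\<integral>\<^sup>+ s. ennreal (potential (w R) s) \<partial>L)"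
    by (intro nn_integral_mono ennreal_leI) (simp add: h_def potential_def sum_nonneg)
  also have "\<dots> \<le> ennreal C"
    unfolding L_def C_def
    by (rule nn_integral_potential_law[where w = w, OF MK Q diff F par w order_refl])
  finally have nn: "(\<integral>\<^sup>+ x. ennreal (h x) \<partial>N) \<le> ennreal C" .
  have int_h: "integrable N h"
    by (rule integrableI_nonneg[OF hN h_nonneg]) (use nn in \<open>simp add: le_less_trans\<close>)
  have "integrable N (\<lambda>x. h x / w R + F xs)" using int_h by simp
  moreover have "h x / w R + F xs = F x" for x using w_pos by (simp add: h_def)
  ultimately have int: "integrable N F" by simp
  then show "integrable (acsa_output d M K R \<beta> \<gamma> Q) F" by (simp add: N_def)
  have "integral\<^sup>L N h \<le> C"
    using nn nn_integral_eq_integral[OF int_h h_nonneg] C by (metis ennreal_le_iff)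
  also have "integral\<^sup>L N h = w R * ((\<integral>x. F x \<partial>N) - F xs)"
    using int by (simp add: h_def[abs_def] N.prob_space)
  finally show "w R * ((\<integral>x. F x \<partial>acsa_output d M K R \<beta> \<gamma> Q) - F xs)
      \<le> (L2_set xs {..<d})\<^sup>2 / 2 + \<sigma>\<^sup>2 / real (M * K) * (\<Sum>t<R. (\<gamma> t)\<^sup>2)"
    by (simp add: N_def C_def)
qed

end

section \<open>The zero step size, the choice of parameters and the final bound\<close>

lemma acsa_update_zero_step: "acsa_update d b 0 (zero_v d, zero_v d) g = (zero_v d, zero_v d)"
  by (auto simp: acsa_update_def lincomb_def zero_v_def restrict_def)

lemma acsa_output_zero_step:
  assumes Q: "gradient_oracle d \<sigma> M K R Fs Q"
  shows "acsa_output d M K R \<beta> (\<lambda>_. 0) Q = return (euclid d) (zero_v d)"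
proof -
  let ?E = "euclid d \<Otimes>\<^sub>M euclid d"
  let ?z = "(zero_v d, zero_v d)"
  have z: "?z \<in> space ?E"
    using zero_v_in_points by (simp add: space_pair_measure space_euclid)
  have "acsa_law d M K \<beta> (\<lambda>_. 0) Q t = return ?E ?z" if "t \<le> R" for t
    using that
  proof (induction t)
    case (Suc t)
    have ker: "acsa_kernel d M K (\<beta> t) 0 (\<lambda>m. Q m t) \<in> ?E \<rightarrow>\<^sub>M prob_algebra ?E"
      using Suc.prems by (intro measurable_acsa_kernel measurable_gradient_oracle[OF Q]) auto
    \<comment> \<open>The update is constant in the answers, and its image law is a point mass
      because the law of the answers has total mass 1.\<close>
    have "prob_space (\<Pi>\<^sub>M q\<in>{..<M} \<times> {..<K}. Q (fst q) t (snd q) (acsa_md d (\<beta> t) ?z))"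
    proof (rule prob_space_PiM)
      fix q assume "q \<in> {..<M} \<times> {..<K}"
      then have "Q (fst q) t (snd q) \<in> euclid d \<rightarrow>\<^sub>M prob_algebra (euclid d)"
        using Suc.prems by (intro measurable_gradient_oracle[OF Q]) auto
      from measurable_space[OF this, of "acsa_md d (\<beta> t) ?z"]
      show "prob_space (Q (fst q) t (snd q) (acsa_md d (\<beta> t) ?z))"
        unfolding space_euclid by (simp only: acsa_md_in_points space_prob_algebra mem_Collect_eq)
    qed
    then have "acsa_kernel d M K (\<beta> t) 0 (\<lambda>m. Q m t) ?z = return ?E ?z"
      unfolding acsa_kernel_def acsa_update_zero_step by (rule prob_space.distr_const[OF _ z])
    then show ?case
      unfolding acsa_law_Suc using Suc bind_return[OF measurable_prob_algebraD[OF ker] z] by simp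
  qed simp
  then show ?thesis
    using z by (simp add: acsa_output_def distr_return)
qed

text \<open>Dividing by the final weight leaves a bias proportional to
  \<open>D = 1 / \<gamma>\<close> and a noise term proportional to \<open>1 / D\<close>. The two
  summands of \<open>D\<close> turn the bias into twice each target term, and the second summand
  alone bounds the noise by one more copy of \<open>s * B / sqrt (real R)\<close>; hence the factor
  3.\<close>

lemma acsa_parameters_bound:
  fixes B H s :: real and R :: nat
  assumes R: "R \<ge> 1" and B: "B > 0" and H: "H > 0" and s: "s \<ge> 0"
  defines "\<gamma> \<equiv> 1 / (H + s * real R * sqrt (real R) / B)"
  assumes a: "\<gamma> * (real R + 1)\<^sup>2 / 4 * a \<le> B\<^sup>2 / 2 + s\<^sup>2 * (\<Sum>t<R. (\<gamma> * (real t + 2) / 2)\<^sup>2)"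
  shows "a \<le> 3 * (H * B\<^sup>2 / (real R)\<^sup>2 + s * B / sqrt (real R))"
proof -
  define r where "r = sqrt (real R)"
  have r: "r > 0" "real R = r\<^sup>2" using R by (auto simp: r_def)
  \<comment> \<open>Writing \<open>real R\<close> as \<open>r^2\<close> makes all half-integer
    powers polynomial in \<open>r\<close>.\<close>
  define D where "D = H + s * r ^ 3 / B"
  have D: "D > 0" using r(1) s H B by (simp add: D_def add_pos_nonneg)
  have \<gamma>: "\<gamma> = 1 / D" using r(1) by (simp add: \<gamma>_def D_def r(2) r_def[symmetric] power2_eq_square power3_eq_cube)
  \<comment> \<open>Each step size is bounded by the last one, at \<open>t = R - 1\<close>; the
    resulting factor \<open>(real R + 1)^2 / 4\<close> also occurs in the final weight and
    cancels.\<close>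
  have "(\<Sum>t<R. (\<gamma> * (real t + 2) / 2)\<^sup>2) \<le> (\<Sum>t<R. \<gamma>\<^sup>2 * ((real R + 1)\<^sup>2 / 4))"
  proof (rule sum_mono)
    fix t assume "t \<in> {..<R}"
    then have "(real t + 2)\<^sup>2 \<le> (real R + 1)\<^sup>2" by (intro power_mono) auto
    then have "\<gamma>\<^sup>2 * ((real t + 2)\<^sup>2 / 4) \<le> \<gamma>\<^sup>2 * ((real R + 1)\<^sup>2 / 4)" by (intro mult_left_mono) auto
    then show "(\<gamma> * (real t + 2) / 2)\<^sup>2 \<le> \<gamma>\<^sup>2 * ((real R + 1)\<^sup>2 / 4)"
      by (simp add: power_mult_distrib power_divide)
  qed
  then have "s\<^sup>2 * (\<Sum>t<R. (\<gamma> * (real t + 2) / 2)\<^sup>2) \<le> s\<^sup>2 * (real R * (\<gamma>\<^sup>2 * ((real R + 1)\<^sup>2 / 4)))"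
    by (intro mult_left_mono) auto
  with a have "\<gamma> * (real R + 1)\<^sup>2 / 4 * a \<le> B\<^sup>2 / 2 + s\<^sup>2 * (real R * (\<gamma>\<^sup>2 * ((real R + 1)\<^sup>2 / 4)))"
    by linarith
  also have "\<dots> = \<gamma> * (real R + 1)\<^sup>2 / 4 * (2 * B\<^sup>2 * D / (real R + 1)\<^sup>2 + s\<^sup>2 * real R / D)"
  proof -
    define p where "p = (real R + 1)\<^sup>2 / 4"
    have p: "(real R + 1)\<^sup>2 = 4 * p" "p > 0" by (simp_all add: p_def)
    show ?thesis using D p(2) unfolding \<gamma> p(1) by (simp add: field_simps power2_eq_square)
  qed
  finally have a_le: "a \<le> 2 * B\<^sup>2 * D / (real R + 1)\<^sup>2 + s\<^sup>2 * real R / D"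
    using D by (subst (asm) mult_le_cancel_left_pos) (auto simp: \<gamma> intro!: divide_pos_pos zero_less_power)
  have "2 * B\<^sup>2 * D / (real R + 1)\<^sup>2 \<le> 2 * B\<^sup>2 * D / (real R)\<^sup>2"
    using D R by (intro divide_left_mono power_mono mult_nonneg_nonneg mult_pos_pos zero_less_power) auto
  also have "2 * B\<^sup>2 * D / (real R)\<^sup>2 = 2 * (H * B\<^sup>2 / (real R)\<^sup>2) + 2 * (s * B / r)"
    using r(1) B by (simp add: D_def r(2) field_simps power2_eq_square power3_eq_cube)
  finally have bias: "2 * B\<^sup>2 * D / (real R + 1)\<^sup>2 \<le> 2 * (H * B\<^sup>2 / (real R)\<^sup>2) + 2 * (s * B / r)" .
  have noise: "s\<^sup>2 * real R / D \<le> s * B / r"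
  proof -
    have "s * r ^ 3 / B \<le> D" using H by (simp add: D_def)
    then have "s * r ^ 3 \<le> B * D" using B by (simp add: pos_divide_le_eq mult.commute)
    \<comment> \<open>Multiplying by \<open>s\<close> rather than dividing by it includes the
      noiseless case \<open>s = 0\<close>.\<close>
    from mult_left_mono[OF this s] have "s\<^sup>2 * r\<^sup>2 * r \<le> s * B * D"
      by (simp add: power2_eq_square power3_eq_cube mult_ac)
    then show ?thesis using r D by (simp add: field_simps)
  qed
  define p where "p = H * B\<^sup>2 / (real R)\<^sup>2"
  define q where "q = s * B / r"
  have "p \<ge> 0" using H by (simp add: p_def)
  moreover have "a \<le> 2 * p + 2 * q + q"
    unfolding p_def q_def by (rule order_trans[OF a_le add_mono[OF bias noise]])
  ultimately have "a \<le> 3 * (p + q)" by simp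
  then show ?thesis by (simp only: p_def q_def r_def)
qed

lemma F0_convex_smooth:
  assumes "f \<in> F0 d H B" "H \<ge> 0"
  obtains xs where "convex_smooth d H f xs" "L2_set xs {..<d} \<le> B" "min_val d f = f xs"
proof -
  obtain xs where xs: "is_arg_min f (\<lambda>x. x \<in> points d) xs" "L2_set xs {..<d} \<le> B"
    and f: "convex_v d f" "smooth_v d H f"
    using assms(1) by (auto simp: F0_def)
  have cs: "convex_smooth d H f xs" using f xs assms(2) by unfold_locales
  then interpret convex_smooth d H f xs .
  have "min_val d f = f xs"
    unfolding min_val_def using xs_in_points F_min by (intro cInf_eq_minimum) auto
  with cs xs(2) show ?thesis by (rule that)
qed

theorem theorem18:
  "\<exists>c::real. c > 0 \<and>
     (\<forall>(M::nat) (K::nat) (R::nat) (H::real) (B::real) (\<sigma>::real).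
        M \<ge> 1 \<and> K \<ge> 1 \<and> R \<ge> 1 \<and> H > 0 \<and> B > 0 \<and> \<sigma> \<ge> 0 \<longrightarrow>
        (\<exists>(\<beta>::nat \<Rightarrow> real) (\<gamma>::nat \<Rightarrow> real).
           (\<forall>t<R. \<beta> t \<ge> 1 \<and> \<gamma> t \<ge> 0) \<and>
           (\<forall>d. \<forall>Fs\<in>F0_het d H B M. \<forall>Q. gradient_oracle d \<sigma> M K R Fs Q \<longrightarrow>
              integrable (acsa_output d M K R \<beta> \<gamma> Q) (avg_obj M Fs) \<and>
              (\<integral>x. avg_obj M Fs x \<partial>acsa_output d M K R \<beta> \<gamma> Q) - min_val d (avg_obj M Fs)
                \<le> c * (H * B\<^sup>2 / (real R)\<^sup>2
                       + min (\<sigma> * B / sqrt (real M * real K * real R)) (H * B\<^sup>2)))))"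
proof (rule exI[of _ 3], intro conjI allI impI, simp, elim conjE)
  fix M K R :: nat and H B \<sigma> :: real
  assume MK: "M \<ge> 1" "K \<ge> 1" and R: "R \<ge> 1" and H: "H > 0" and B: "B > 0" and \<sigma>: "\<sigma> \<ge> 0"
  let ?noise = "\<sigma> * B / sqrt (real M * real K * real R)"
  let ?bound = "3 * (H * B\<^sup>2 / (real R)\<^sup>2 + min ?noise (H * B\<^sup>2))"
  show "\<exists>(\<beta>::nat \<Rightarrow> real) (\<gamma>::nat \<Rightarrow> real). (\<forall>t<R. \<beta> t \<ge> 1 \<and> \<gamma> t \<ge> 0) \<and>
      (\<forall>d. \<forall>Fs\<in>F0_het d H B M. \<forall>Q. gradient_oracle d \<sigma> M K R Fs Q \<longrightarrow>
        integrable (acsa_output d M K R \<beta> \<gamma> Q) (avg_obj M Fs) \<and>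
        (\<integral>x. avg_obj M Fs x \<partial>acsa_output d M K R \<beta> \<gamma> Q) - min_val d (avg_obj M Fs) \<le> ?bound)"
  \<comment> \<open>The split decides which argument of the minimum is active. It involves only
    \<open>M\<close>, \<open>K\<close>, \<open>R\<close>, \<open>H\<close>, \<open>B\<close> and
    \<open>\<sigma>\<close>, so the parameters are fixed before the dimension, the objective and the
    oracle.\<close>
  proof (cases "H * B\<^sup>2 \<le> ?noise")
    case True
    show ?thesis
    proof (rule exI[of _ "\<lambda>_. 1"], rule exI[of _ "\<lambda>_. 0"], intro conjI allI ballI impI)
      fix d Fs Q assume Fs: "Fs \<in> F0_het d H B M" and Q: "gradient_oracle d \<sigma> M K R Fs Q"
      define F where "F = avg_obj M Fs"
      have "F \<in> F0 d H B" using Fs by (simp add: F0_het_def F_def)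
      then obtain xs where cs: "convex_smooth d H F xs" and xs: "L2_set xs {..<d} \<le> B"
        and min: "min_val d F = F xs"
        using H by (elim F0_convex_smooth) simp_all
      interpret convex_smooth d H F xs by (fact cs)
      have z: "zero_v d \<in> space (euclid d)" using zero_v_in_points by (simp add: space_euclid)
      note out = acsa_output_zero_step[OF Q]
      show "integrable (acsa_output d M K R (\<lambda>_. 1) (\<lambda>_. 0) Q) (avg_obj M Fs)"
        unfolding out F_def[symmetric] using measurable_F z
        by (intro integrableI_bounded) (auto simp: nn_integral_return)
      have "F (zero_v d) - F xs \<le> H / 2 * (L2_set xs {..<d})\<^sup>2" by (rule F_zero_le)
      also have "\<dots> \<le> H / 2 * B\<^sup>2" using H xs by (intro mult_left_mono power_mono) auto
      also have "\<dots> \<le> 3 * (H * B\<^sup>2)" using H by simp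
      also have "\<dots> \<le> ?bound" using True H by simp
      finally show "(\<integral>x. avg_obj M Fs x \<partial>acsa_output d M K R (\<lambda>_. 1) (\<lambda>_. 0) Q)
          - min_val d (avg_obj M Fs) \<le> ?bound"
        unfolding out F_def[symmetric] min using integral_return[OF z measurable_F] by simp
    qed simp_all
  next
    case False
    \<comment> \<open>The standard deviation bound of the averaged gradient.\<close>
    define s where "s = \<sigma> / sqrt (real (M * K))"
    define \<gamma> where "\<gamma> = 1 / (H + s * real R * sqrt (real R) / B)"
    \<comment> \<open>For positive \<open>t\<close> this is the weight left by round
      \<open>t - 1\<close>. The value at 0 is set to 0 rather than \<open>\<gamma> / 4\<close>,
      which is compatible with \<open>w_ge\<close> because the first \<open>\<beta>\<close> equals
      1.\<close>
    define w where "w t = (if t = 0 then 0 else \<gamma> * (real t + 1)\<^sup>2 / 4)" for t :: nat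
    have s: "s \<ge> 0" "s\<^sup>2 = \<sigma>\<^sup>2 / real (M * K)" using \<sigma> by (auto simp: s_def power_divide)
    have \<gamma>: "\<gamma> > 0" "H * \<gamma> \<le> 1"
      using H B s by (auto simp: \<gamma>_def add_pos_nonneg divide_le_eq)
    have noise: "?noise = s * B / sqrt (real R)" by (simp add: s_def real_sqrt_mult)
    show ?thesis
    proof (rule exI[of _ "\<lambda>t. (real t + 2) / 2"], rule exI[of _ "\<lambda>t. \<gamma> * (real t + 2) / 2"], intro conjI allI ballI impI)
      fix d Fs Q assume Fs: "Fs \<in> F0_het d H B M" and Q: "gradient_oracle d \<sigma> M K R Fs Q"
      define F where "F = avg_obj M Fs"
      have "F \<in> F0 d H B" using Fs by (simp add: F0_het_def F_def)
      then obtain xs where cs: "convex_smooth d H F xs" and xs: "L2_set xs {..<d} \<le> B"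
        and min: "min_val d F = F xs"
        using H by (elim F0_convex_smooth) simp_all
      interpret convex_smooth d H F xs by (fact cs)
      have diff: "differentiable_v d (Fs m)" if "m < M" for m
        using Fs that by (simp add: F0_het_def)
      let ?N = "acsa_output d M K R (\<lambda>t. (real t + 2) / 2) (\<lambda>t. \<gamma> * (real t + 2) / 2) Q"
      have H_par: "H * (\<gamma> * (real t + 2) / 2) \<le> (real t + 2) / 2" for t
        using mult_right_mono[OF \<gamma>(2), of "(real t + 2) / 2"] by simp
      have w_Suc: "w (Suc t) = \<gamma> * (real t + 2) / 2 * ((real t + 2) / 2)" for t
        by (simp add: w_def power2_eq_square algebra_simps)
      \<comment> \<open>For positive \<open>t\<close> this is
        \<open>t * (t + 2) \<le> (t + 1)^2\<close>, scaled by \<open>\<gamma> / 4\<close>.\<close>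
      have w_ge: "\<gamma> * (real t + 2) / 2 * ((real t + 2) / 2 - 1) \<le> w t" for t
        using \<gamma>(1) by (simp add: w_def power2_eq_square field_simps)
      have w_pos: "w R > 0" using R \<gamma>(1) by (simp add: w_def)
      have concl: "integrable ?N F" "w R * ((\<integral>x. F x \<partial>?N) - F xs)
          \<le> (L2_set xs {..<d})\<^sup>2 / 2 + \<sigma>\<^sup>2 / real (M * K) * (\<Sum>t<R. (\<gamma> * (real t + 2) / 2)\<^sup>2)"
        by (rule acsa_output_suboptimality[where w = w, OF MK Q diff F_def _ _ H_par _ w_Suc w_ge w_pos];
            use \<gamma>(1) in \<open>simp add: w_def\<close>)+
      from concl(1) show "integrable ?N (avg_obj M Fs)" by (simp add: F_def)
      have "(L2_set xs {..<d})\<^sup>2 \<le> B\<^sup>2" using xs by (intro power_mono) auto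
      with concl(2) have "\<gamma> * (real R + 1)\<^sup>2 / 4 * ((\<integral>x. F x \<partial>?N) - F xs)
          \<le> B\<^sup>2 / 2 + s\<^sup>2 * (\<Sum>t<R. (\<gamma> * (real t + 2) / 2)\<^sup>2)"
        using R unfolding w_def s(2) by simp
      from acsa_parameters_bound[OF R B H s(1) this[unfolded \<gamma>_def]]
      have "(\<integral>x. F x \<partial>?N) - F xs \<le> 3 * (H * B\<^sup>2 / (real R)\<^sup>2 + ?noise)"
        unfolding noise \<gamma>_def .
      then show "(\<integral>x. avg_obj M Fs x \<partial>?N) - min_val d (avg_obj M Fs) \<le> ?bound"
        using False unfolding F_def[symmetric] min by simp
    qed (use \<gamma>(1) in simp_all)
  qed
qed

end
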